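(* Let $\mathcal{F}$ be a saturated fusion system over a finite $p$-group $S$. Then $\mathrm{rank}_{w}(\mathcal{F})=1$ if and only if $\mathcal{F}^e=\{O_p(\mathcal{F})\}$, where $\mathcal{F}^e$ is the set of $\mathcal{F}$-essential subgroups of $S$ and $\mathrm{rank}_w(\mathcal{F})$ is the weakly local rank of $\mathcal{F}$.
   Context: A fusion system $\mathcal{F}$ over a finite $p$-group $S$ is a category whose objects are the subgroups of $S$, whose morphisms are injective group homomorphisms, which contains all homomorphisms induced by conjugation by elements of $S$, and in which every morphism is an $\mathcal{F}$-isomorphism followed by an inclusion; saturation is the usual notion. $Q\le S$ is $\mathcal{F}$-essential if it is fully $\mathcal{F}$-normalised ($|N_S(Q)|\ge|N_S(R)|$ for all $R$ $\mathcal{F}$-isomorphic to $Q$), $\mathcal{F}$-centric ($C_S(R)=Z(R)$ for all $R$ $\mathcal{F}$-isomorphic to $Q$), and $\mathrm{Out}_{\mathcal{F}}(Q)=\mathrm{Aut}_{\mathcal{F}}(Q)/\mathrm{Inn}(Q)$ has a strongly $p$-embedded subgroup. For a fusion system $\mathcal{E}$ over $T$ (not necessarily saturated) and $Q\le T$, $N_{\mathcal{E}}(Q)$ is the fusion system over $N_T(Q)$ whose morphisms $U\to V$ are those $\varphi\in\mathrm{Hom}_{\mathcal{E}}(U,V)$ having an extension $\tilde\varphi\in\mathrm{Hom}_{\mathcal{E}}(UQ,VQ)$ with $\tilde\varphi(Q)=Q$. $Q$ is normal in $\mathcal{E}$ if $N_{\mathcal{E}}(Q)=\mathcal{E}$,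 and $O_p(\mathcal{E})$ is the largest subgroup of $T$ normal in $\mathcal{E}$. $Q$ is weakly centric-radical in $\mathcal{E}$ if $O_p(N_{\mathcal{E}}(Q))=Q$. For a chain $\sigma\colon Q_0<Q_1<\cdots<Q_n$ of subgroups of $S$, let $\sigma_i\colon Q_0<\cdots<Q_i$, $N_{\mathcal{F}}(\sigma_0)=N_{\mathcal{F}}(Q_0)$ and $N_{\mathcal{F}}(\sigma_i)=N_{N_{\mathcal{F}}(\sigma_{i-1})}(Q_i)$. The chain is weakly centric-radical in $\mathcal{F}$ if $N_{\mathcal{F}}(Q_0)=\mathcal{F}$, $O_p(\mathcal{F})<Q_1$, and $Q_i$ is weakly centric-radical in $N_{\mathcal{F}}(\sigma_{i-1})$ for $1\le i\le n$. Its length is $n$. The weakly local rank $\mathrm{rank}_w(\mathcal{F})$ is the length of a longest weakly centric-radical chain in $\mathcal{F}$. Equivalently: $\mathrm{rank}_w(\mathcal{F})=0$ if $O_p(\mathcal{F})=S$, and otherwise $\mathrm{rank}_w(\mathcal{F})=1+\max\{\mathrm{rank}_w(N_{\mathcal{F}}(R)) : R\le S,\ O_p(N_{\mathcal{F}}(R))=R,\ O_p(\mathcal{F})<R\}$. *)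

theory Defs
  imports "HOL-Algebra.Group_Action" "HOL-Computational_Algebra.Primes"
begin

section \<open>Group-theoretic notions\<close>

text \<open>Group homomorphisms are compared as functions, so everything defined on a
  subgroup \<open>U\<close> is taken extensional on \<open>U\<close>.\<close>

definition conj_map :: "('a, 'b) monoid_scheme \<Rightarrow> 'a \<Rightarrow> 'a set \<Rightarrow> 'a \<Rightarrow> 'a" where
  "conj_map G g U = (\<lambda>x\<in>U. g \<otimes>\<^bsub>G\<^esub> x \<otimes>\<^bsub>G\<^esub> inv\<^bsub>G\<^esub> g)"

definition centralizer :: "('a, 'b) monoid_scheme \<Rightarrow> 'a set \<Rightarrow> 'a set" where
  "centralizer G U = {g \<in> carrier G. \<forall>x\<in>U. g \<otimes>\<^bsub>G\<^esub> x = x \<otimes>\<^bsub>G\<^esub> g}"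

definition group_center :: "('a, 'b) monoid_scheme \<Rightarrow> 'a set" where
  "group_center G = centralizer G (carrier G)"

definition sylow_subgroup :: "nat \<Rightarrow> 'a set \<Rightarrow> ('a, 'b) monoid_scheme \<Rightarrow> bool" where
  "sylow_subgroup p H G \<longleftrightarrow> subgroup H G \<and> card H = p ^ multiplicity p (order G)"

definition strongly_embedded :: "nat \<Rightarrow> 'a set \<Rightarrow> ('a, 'b) monoid_scheme \<Rightarrow> bool" where
  "strongly_embedded p H G \<longleftrightarrow>
     subgroup H G \<and> H \<noteq> carrier G \<and> p dvd card H \<and>
     (\<forall>g \<in> carrier G - H. \<not> p dvd card (H \<inter> (g <#\<^bsub>G\<^esub> H #>\<^bsub>G\<^esub> inv\<^bsub>G\<^esub> g)))"


section \<open>Fusion systems\<close>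

text \<open>\<open>fgrp E\<close> is the group over which \<open>E\<close> is defined and \<open>fhom E U V\<close> is the set
  \<open>Hom\<^sub>E(U, V)\<close>; it is required to be empty unless \<open>U\<close> and \<open>V\<close> are subgroups of \<open>fgrp E\<close>, so
  that equality of fusion systems is equality of records.\<close>

record 'a fusion =
  fgrp :: "'a monoid"
  fhom :: "'a set \<Rightarrow> 'a set \<Rightarrow> ('a \<Rightarrow> 'a) set"

definition fiso :: "'a fusion \<Rightarrow> 'a set \<Rightarrow> 'a set \<Rightarrow> ('a \<Rightarrow> 'a) set" where
  "fiso E U V = {\<phi> \<in> fhom E U V. \<exists>\<psi> \<in> fhom E V U.
      compose U \<psi> \<phi> = (\<lambda>x\<in>U. x) \<and> compose V \<phi> \<psi> = (\<lambda>y\<in>V. y)}"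

definition fconj :: "'a fusion \<Rightarrow> 'a set \<Rightarrow> 'a set \<Rightarrow> bool" where
  "fconj E U V \<longleftrightarrow> fiso E U V \<noteq> {}"

text \<open>Identities and inclusions are morphisms by \<open>conj_in_fhom\<close> with \<open>g = 1\<close>.
  In \<open>iso_onto_image\<close> the inclusion of \<open>\<phi> ` U\<close> into \<open>V\<close> does not show because \<open>\<phi>\<close> is the same
  function when viewed as a map onto its image.\<close>

locale fusion_system =
  fixes p :: nat and E :: "'a fusion"
  assumes prime_p: "prime p"
    and group_fgrp: "group (fgrp E)"
    and p_group_fgrp: "\<exists>k. order (fgrp E) = p ^ k"
    and fhom_objects: "\<phi> \<in> fhom E U V \<Longrightarrow> subgroup U (fgrp E) \<and> subgroup V (fgrp E)"
    and fhom_inj_hom: "\<phi> \<in> fhom E U V \<Longrightarrow>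
          \<phi> \<in> extensional U \<and> inj_on \<phi> U \<and>
          \<phi> \<in> hom (fgrp E\<lparr>carrier := U\<rparr>) (fgrp E\<lparr>carrier := V\<rparr>)"
    and fhom_compose: "\<phi> \<in> fhom E U V \<Longrightarrow> \<psi> \<in> fhom E V W \<Longrightarrow> compose U \<psi> \<phi> \<in> fhom E U W"
    and conj_in_fhom: "subgroup U (fgrp E) \<Longrightarrow> subgroup V (fgrp E) \<Longrightarrow> g \<in> carrier (fgrp E) \<Longrightarrow>
          conj_map (fgrp E) g U ` U \<subseteq> V \<Longrightarrow> conj_map (fgrp E) g U \<in> fhom E U V"
    and iso_onto_image: "\<phi> \<in> fhom E U V \<Longrightarrow> \<phi> \<in> fiso E U (\<phi> ` U)"

definition faut :: "'a fusion \<Rightarrow> 'a set \<Rightarrow> ('a \<Rightarrow> 'a) monoid" where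
  "faut E Q = (BijGroup Q)\<lparr>carrier := fhom E Q Q\<rparr>"

definition finn :: "'a fusion \<Rightarrow> 'a set \<Rightarrow> ('a \<Rightarrow> 'a) set" where
  "finn E Q = (\<lambda>g. conj_map (fgrp E) g Q) ` Q"

definition fout :: "'a fusion \<Rightarrow> 'a set \<Rightarrow> ('a \<Rightarrow> 'a) set monoid" where
  "fout E Q = faut E Q Mod finn E Q"

text \<open>\<open>Aut\<^sub>S(Q)\<close>, where \<open>S = fgrp E\<close>.\<close>

definition faut_grp :: "'a fusion \<Rightarrow> 'a set \<Rightarrow> ('a \<Rightarrow> 'a) set" where
  "faut_grp E Q = (\<lambda>g. conj_map (fgrp E) g Q) ` normalizer (fgrp E) Q"

definition fully_normalized :: "'a fusion \<Rightarrow> 'a set \<Rightarrow> bool" where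
  "fully_normalized E Q \<longleftrightarrow> subgroup Q (fgrp E) \<and>
     (\<forall>R. fconj E Q R \<longrightarrow> card (normalizer (fgrp E) R) \<le> card (normalizer (fgrp E) Q))"

definition fully_centralized :: "'a fusion \<Rightarrow> 'a set \<Rightarrow> bool" where
  "fully_centralized E Q \<longleftrightarrow> subgroup Q (fgrp E) \<and>
     (\<forall>R. fconj E Q R \<longrightarrow> card (centralizer (fgrp E) R) \<le> card (centralizer (fgrp E) Q))"

text \<open>\<open>N\<^sub>\<phi> = {g \<in> N\<^sub>S(U). \<phi> \<circ> c\<^sub>g \<circ> \<phi>\<^sup>-\<^sup>1 \<in> Aut\<^sub>S(\<phi>(U))}\<close> for \<open>\<phi> \<in> Hom\<^sub>E(U, S)\<close>.\<close>

definition ext_dom :: "'a fusion \<Rightarrow> 'a set \<Rightarrow> ('a \<Rightarrow> 'a) \<Rightarrow> 'a set" where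
  "ext_dom E U \<phi> = {g \<in> normalizer (fgrp E) U.
     restrict (\<phi> \<circ> conj_map (fgrp E) g U \<circ> inv_into U \<phi>) (\<phi> ` U) \<in> faut_grp E (\<phi> ` U)}"

text \<open>Saturation in the sense of Broto--Levi--Oliver.\<close>

locale saturated_fusion_system = fusion_system +
  assumes fully_normalized_centralized: "fully_normalized E U \<Longrightarrow> fully_centralized E U"
    and fully_normalized_sylow:
      "fully_normalized E U \<Longrightarrow> sylow_subgroup p (faut_grp E U) (faut E U)"
    and extension: "\<phi> \<in> fhom E U (carrier (fgrp E)) \<Longrightarrow> fully_centralized E (\<phi> ` U) \<Longrightarrow>
          \<exists>\<psi> \<in> fhom E (ext_dom E U \<phi>) (carrier (fgrp E)). restrict \<psi> U = \<phi>"

definition fcentric :: "'a fusion \<Rightarrow> 'a set \<Rightarrow> bool" where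
  "fcentric E Q \<longleftrightarrow> subgroup Q (fgrp E) \<and>
     (\<forall>R. fconj E Q R \<longrightarrow> centralizer (fgrp E) R = group_center (fgrp E\<lparr>carrier := R\<rparr>))"

definition fessential :: "nat \<Rightarrow> 'a fusion \<Rightarrow> 'a set set" where
  "fessential p E = {Q. subgroup Q (fgrp E) \<and> fully_normalized E Q \<and> fcentric E Q \<and>
     (\<exists>H. strongly_embedded p H (fout E Q))}"


section \<open>Normalizers and the weakly local rank\<close>

definition fnormalizer :: "'a fusion \<Rightarrow> 'a set \<Rightarrow> 'a fusion" where
  "fnormalizer E Q =
     (let T = fgrp E; N = T\<lparr>carrier := normalizer T Q\<rparr> in
      \<lparr>fgrp = N,
       fhom = (\<lambda>U V. {\<phi> \<in> fhom E U V. subgroup U N \<and> subgroup V N \<and>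
         (\<exists>\<psi> \<in> fhom E (U <#>\<^bsub>T\<^esub> Q) (V <#>\<^bsub>T\<^esub> Q). restrict \<psi> U = \<phi> \<and> \<psi> ` Q = Q)})\<rparr>)"

definition fnormal :: "'a fusion \<Rightarrow> 'a set \<Rightarrow> bool" where
  "fnormal E Q \<longleftrightarrow> subgroup Q (fgrp E) \<and> fnormalizer E Q = E"

definition fcore :: "'a fusion \<Rightarrow> 'a set" where
  "fcore E = (GREATEST Q. fnormal E Q)"

definition weakly_centric_radical :: "'a fusion \<Rightarrow> 'a set \<Rightarrow> bool" where
  "weakly_centric_radical E Q \<longleftrightarrow> subgroup Q (fgrp E) \<and> fcore (fnormalizer E Q) = Q"

text \<open>\<open>N\<^sub>E(\<sigma>)\<close> for the chain \<open>\<sigma>\<close> given by the list \<open>[Q\<^sub>0, \<dots>, Q\<^sub>n]\<close>.\<close>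

definition chain_normalizer :: "'a fusion \<Rightarrow> 'a set list \<Rightarrow> 'a fusion" where
  "chain_normalizer E Qs = foldl fnormalizer E Qs"

text \<open>In the last conjunct \<open>take i Qs\<close> is the chain \<open>\<sigma>\<^bsub>i-1\<^esub>\<close>, with members \<open>Q\<^sub>0, \<dots>, Q\<^bsub>i-1\<^esub>\<close>.
  A chain consisting of \<open>Q\<^sub>0\<close> alone carries no condition on \<open>Q\<^sub>1\<close>.\<close>

definition weakly_centric_radical_chain :: "'a fusion \<Rightarrow> 'a set list \<Rightarrow> bool" where
  "weakly_centric_radical_chain E Qs \<longleftrightarrow>
     Qs \<noteq> [] \<and> (\<forall>Q \<in> set Qs. subgroup Q (fgrp E)) \<and> sorted_wrt (\<subset>) Qs \<and>
     fnormalizer E (Qs ! 0) = E \<and>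
     (1 < length Qs \<longrightarrow> fcore E \<subset> Qs ! 1) \<and>
     (\<forall>i. 1 \<le> i \<and> i < length Qs \<longrightarrow>
        weakly_centric_radical (chain_normalizer E (take i Qs)) (Qs ! i))"

definition weakly_local_rank :: "'a fusion \<Rightarrow> nat" where
  "weakly_local_rank E = Max {length Qs - 1 |Qs. weakly_centric_radical_chain E Qs}"

end

theory Submission
  imports Defs "HOL-Algebra.Sylow" "HOL-Algebra.Zassenhaus"
begin

text \<open>Let \<open>S\<close> be the group over which \<open>F\<close> is defined. A chain of length 1 above \<open>O\<^sub>p(F)\<close> always exists
when \<open>O\<^sub>p(F) \<noteq> S\<close>, because \<open>S\<close> itself is weakly centric-radical; and a weakly centric-radical
subgroup \<open>R\<close> strictly between \<open>O\<^sub>p(F)\<close> and \<open>S\<close> always prolongs to a chain of length 2, because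
\<open>N\<^sub>S(R) > R\<close> is weakly centric-radical in \<open>N\<^sub>F(R)\<close> for the same reason. Hence the rank is 1 exactly
when \<open>O\<^sub>p(F) \<noteq> S\<close> and no weakly centric-radical subgroup lies strictly between the two
(\<open>weakly_local_rank_eq_1_iff\<close>).

Two facts connect this condition with the essential subgroups.

First, let \<open>Q\<close> be essential. A strongly \<open>p\<close>-embedded subgroup of \<open>Out\<^sub>F(Q)\<close> forces every normal
\<open>p\<close>-subgroup of \<open>Aut\<^sub>F(Q)\<close> that contains \<open>Inn(Q)\<close> to be \<open>Inn(Q)\<close>. So a group \<open>M\<close> with
\<open>Q \<le> M \<le> N\<^sub>S(Q)\<close> to which all automorphisms of \<open>Q\<close> extend acts on \<open>Q\<close> by inner automorphisms, and
\<open>M = Q\<close> as \<open>Q\<close> is centric (\<open>aut_invariant_overgroup_eq\<close>). Taking \<open>M = N\<^bsub>Q O\<^sub>p(F)\<^esub>(Q)\<close> gives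
\<open>O\<^sub>p(F) \<le> Q\<close>, and taking \<open>M = O\<^sub>p(N\<^sub>F(Q))\<close> shows that \<open>Q\<close> is weakly centric-radical. Since \<open>S\<close> is not
essential, rank 1 leaves \<open>Q = O\<^sub>p(F)\<close> as the only possibility.

Second, there is a form of Alperin's fusion theorem (\<open>extends_to_fgrp_if_no_large_essential\<close>): if
all essential subgroups have order less than \<open>n\<close>, then every morphism from a subgroup of order at
least \<open>n\<close> extends to an automorphism of \<open>S\<close>. With no essential subgroups at all, \<open>S\<close> is normal in \<open>F\<close>,
which is impossible in rank 1. And if \<open>O\<^sub>p(F)\<close> is the only essential subgroup, then for
\<open>O\<^sub>p(F) < R < S\<close> every morphism of \<open>N\<^sub>F(R)\<close> extends to an automorphism of \<open>S\<close> that stabilises \<open>R\<close>,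
hence also \<open>N\<^sub>S(R)\<close>; so \<open>N\<^sub>S(R) > R\<close> is normal in \<open>N\<^sub>F(R)\<close>, and \<open>R\<close> is not weakly centric-radical.\<close>

section \<open>Finite \<open>p\<close>-groups acting on cosets\<close>

lemma (in group_action) p_group_fixed_point:
  assumes "prime p" "order G = p ^ k" "finite E" "\<not> p dvd card E"
  shows "\<exists>x\<in>E. \<forall>g\<in>carrier G. \<phi> g x = x"
proof (rule ccontr)
  assume no_fix: "\<not> ?thesis"
  have "p dvd card B" if B: "B \<in> orbits G E \<phi>" for B
  proof -
    obtain x where x: "x \<in> E" "B = orbit G \<phi> x"
      using B by (auto simp: orbits_def)
    have "card B dvd p ^ k"
      using orbit_stabilizer_theorem[OF x(1)] assms(2) x(2) by (metis dvd_triv_left)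
    then obtain j where j: "card B = p ^ j"
      using assms(1) by (auto simp: divides_primepow_nat)
    have "j \<noteq> 0"
    proof
      assume "j = 0"
      then obtain y where y: "B = {y}"
        using j by (auto simp: card_1_singleton_iff)
      have "\<phi> g x = x" if "g \<in> carrier G" for g
      proof -
        have "\<phi> g x \<in> B" "x \<in> B"
          using that x orbit_refl by (auto simp: orbit_def)
        then show ?thesis using y by simp
      qed
      then show False using no_fix x(1) by blast
    qed
    then show ?thesis using j assms(1) by (auto intro: dvd_power)
  qed
  then have "p dvd (\<Sum>B\<in>orbits G E \<phi>. card B)"
    by (rule dvd_sum)
  moreover have "(\<Sum>B\<in>orbits G E \<phi>. card B) = card E"
    using disjoint_sum[OF assms(3), of "\<lambda>_. 1 :: nat"] by simp
  ultimately show False using assms(4) by simp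
qed

text \<open>Acting on the cosets inside a set \<open>W\<close>, rather than on all of them, allows a known fixed coset to be
removed before the fixed points are counted.\<close>

lemma (in group) r_coset_action:
  assumes X: "subgroup X G" and P: "subgroup P G" and W: "W \<subseteq> carrier G"
    and WX: "\<And>w x. w \<in> W \<Longrightarrow> x \<in> X \<Longrightarrow> w \<otimes> x \<in> W"
  shows "group_action (G\<lparr>carrier := X\<rparr>) ((#>) P ` W)
           (\<lambda>x. \<lambda>C\<in>(#>) P ` W. C #> inv x)"
proof -
  interpret X: group "G\<lparr>carrier := X\<rparr>"
    using X by (simp add: subgroup_imp_group)
  let ?\<Omega> = "(#>) P ` W"
  have sub: "C \<subseteq> carrier G" if "C \<in> ?\<Omega>" for C
    using that W P r_coset_subset_G subgroup.subset by blast
  have Xc: "x \<in> carrier G" if "x \<in> X" for x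
    using X that subgroup.mem_carrier by metis
  have inX: "inv x \<in> X" if "x \<in> X" for x
    using X that by (simp add: subgroup.m_inv_closed)
  have closed: "C #> x \<in> ?\<Omega>" if "C \<in> ?\<Omega>" "x \<in> X" for C x
  proof -
    obtain w where w: "w \<in> W" "C = P #> w" using \<open>C \<in> ?\<Omega>\<close> by blast
    then have "C #> x = P #> (w \<otimes> x)"
      using coset_mult_assoc[of P w x] P W Xc[OF \<open>x \<in> X\<close>] subgroup.subset by auto
    then show ?thesis using WX[OF w(1) \<open>x \<in> X\<close>] by blast
  qed
  have bij: "(\<lambda>C\<in>?\<Omega>. C #> inv x) \<in> Bij ?\<Omega>" if x: "x \<in> X" for x
    unfolding Bij_def
  proof (intro IntI CollectI restrict_extensional)
    show "bij_betw (\<lambda>C\<in>?\<Omega>. C #> inv x) ?\<Omega> ?\<Omega>"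
      by (rule bij_betw_byWitness[where f' = "\<lambda>C. C #> x"])
        (use closed x inX in \<open>auto simp: coset_mult_assoc sub Xc W P subgroup.subset subsetD\<close>)
  qed
  have "(\<lambda>x. \<lambda>C\<in>?\<Omega>. C #> inv x) \<in> hom (G\<lparr>carrier := X\<rparr>) (BijGroup ?\<Omega>)"
  proof (rule homI)
    fix x y assume x: "x \<in> carrier (G\<lparr>carrier := X\<rparr>)" and y: "y \<in> carrier (G\<lparr>carrier := X\<rparr>)"
    have "C #> inv (x \<otimes> y) = (C #> inv y) #> inv x" if "C \<in> ?\<Omega>" for C
      using that x y by (simp add: inv_mult_group Xc sub coset_mult_assoc)
    then show "(\<lambda>C\<in>?\<Omega>. C #> inv (x \<otimes>\<^bsub>G\<lparr>carrier := X\<rparr>\<^esub> y)) =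
        (\<lambda>C\<in>?\<Omega>. C #> inv x) \<otimes>\<^bsub>BijGroup ?\<Omega>\<^esub> (\<lambda>C\<in>?\<Omega>. C #> inv y)"
      using bij x y closed inX by (auto simp: BijGroup_def compose_def fun_eq_iff restrict_def)
  qed (use bij in \<open>simp add: BijGroup_def\<close>)
  then show ?thesis
    unfolding group_action_def group_hom_def group_hom_axioms_def
    using X.is_group group_BijGroup by blast
qed

text \<open>The group \<open>X\<close> acts by right multiplication on the \<open>m\<close> cosets of \<open>P\<close> that make up \<open>W\<close>, and a fixed
coset \<open>P w\<close> is one with \<open>w X w\<^sup>-\<^sup>1 \<le> P\<close>. The case \<open>W = G\<close> is Sylow's conjugacy theorem, and \<open>W = G - P\<close>
says that normalizers grow in \<open>p\<close>-groups.\<close>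

lemma (in group) p_subgroup_conj_into:
  assumes fin: "finite (carrier G)" and p: "prime p"
    and P: "subgroup P G" and X: "subgroup X G" "card X = p ^ k"
    and W: "W \<subseteq> carrier G"
    and PW: "\<And>a w. a \<in> P \<Longrightarrow> w \<in> W \<Longrightarrow> a \<otimes> w \<in> W"
    and WX: "\<And>w x. w \<in> W \<Longrightarrow> x \<in> X \<Longrightarrow> w \<otimes> x \<in> W"
    and cW: "card W = card P * m" and m: "\<not> p dvd m"
  shows "\<exists>w\<in>W. \<forall>x\<in>X. w \<otimes> x \<otimes> inv w \<in> P"
proof -
  let ?\<Omega> = "(#>) P ` W"
  interpret act: group_action "G\<lparr>carrier := X\<rparr>" ?\<Omega> "\<lambda>x. \<lambda>C\<in>?\<Omega>. C #> inv x"
    by (rule r_coset_action[OF X(1) P W WX])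
  have finW: "finite W" using W fin finite_subset by blast
  have Psub: "P \<subseteq> carrier G" using P subgroup.subset by blast
  have \<Omega>: "?\<Omega> \<subseteq> rcosets P"
    using W Psub by (auto simp: RCOSETS_def)
  have union: "\<Union>?\<Omega> = W"
  proof
    show "\<Union>?\<Omega> \<subseteq> W" using PW by (auto simp: r_coset_def)
    show "W \<subseteq> \<Union>?\<Omega>" using P W by (force intro: rcos_self)
  qed
  have "card P * card ?\<Omega> = card (\<Union>?\<Omega>)"
  proof (rule card_partition)
    show "finite ?\<Omega>" "finite (\<Union>?\<Omega>)" using finW union by auto
    show "\<And>c. c \<in> ?\<Omega> \<Longrightarrow> card c = card P"
      using \<Omega> card_rcosets_equal Psub by (metis subsetD)
    show "\<And>c1 c2. c1 \<in> ?\<Omega> \<Longrightarrow> c2 \<in> ?\<Omega> \<Longrightarrow> c1 \<noteq> c2 \<Longrightarrow> c1 \<inter> c2 = {}"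
      using rcos_disjoint[OF P] \<Omega> unfolding pairwise_def disjnt_def by (meson subsetD)
  qed
  moreover have "card P > 0"
    using P Psub fin by (metis card_gt_0_iff empty_iff finite_subset subgroup.one_closed)
  ultimately have "card ?\<Omega> = m" using union cW by simp
  then obtain C where C: "C \<in> ?\<Omega>" "\<forall>x\<in>X. (\<lambda>C\<in>?\<Omega>. C #> inv x) C = C"
    using act.p_group_fixed_point[OF p, of k] X finW m by (auto simp: order_def)
  then obtain w where w: "w \<in> W" "C = P #> w" by blast
  have wc: "w \<in> carrier G" using w W by blast
  have "w \<otimes> x \<otimes> inv w \<in> P" if x: "x \<in> X" for x
  proof -
    have xc: "x \<in> carrier G" and ix: "inv x \<in> X"
      using X(1) x subgroup.mem_carrier subgroup.m_inv_closed by metis+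
    have "(P #> w) #> inv (inv x) = P #> w" using C ix w by force
    then have "P #> (w \<otimes> x) = P #> w"
      using Psub wc xc by (simp add: coset_mult_assoc)
    then have "w \<otimes> x \<in> P #> w"
      using rcos_self[OF _ P, of "w \<otimes> x"] wc xc by auto
    then obtain a where a: "a \<in> P" "w \<otimes> x = a \<otimes> w" by (auto simp: r_coset_def)
    then have "w \<otimes> x \<otimes> inv w = a" using wc Psub by (simp add: m_assoc subsetD)
    then show ?thesis using a by simp
  qed
  then show ?thesis using w(1) by blast
qed

lemma (in group) sylow_conj_into:
  assumes fin: "finite (carrier G)" and p: "prime p"
    and P: "subgroup P G" "card P = p ^ multiplicity p (order G)"
    and X: "subgroup X G" "card X = p ^ k"
  shows "\<exists>w\<in>carrier G. \<forall>x\<in>X. w \<otimes> x \<otimes> inv w \<in> P"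
proof -
  have pos: "order G \<noteq> 0" using fin by (simp add: order_gt_0_iff_finite)
  have "\<not> is_unit p" using p not_prime_unit by blast
  then obtain m where m: "order G = p ^ multiplicity p (order G) * m" "\<not> p dvd m"
    using multiplicity_decompose'[of "order G" p] pos by metis
  show ?thesis
  proof (rule p_subgroup_conj_into[OF fin p P(1) X subset_refl])
    show "card (carrier G) = card P * m" using m(1) P(2) by (simp add: order_def)
  qed (use m(2) subgroup.mem_carrier[OF P(1)] subgroup.mem_carrier[OF X(1)] in simp_all)
qed

lemma card_subgroup_p_power:
  assumes "group G" "subgroup H G" "order G = p ^ k" "prime (p::nat)"
  obtains j where "card H = p ^ j"
  using group.lagrange[OF assms(1,2)] assms(3,4) that
  by (metis divides_primepow_nat dvd_triv_right)

lemma (in group) conj_coset_eq_image: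
  "g <# H #> inv g = (\<lambda>x. g \<otimes> x \<otimes> inv g) ` H"
  by (auto simp: l_coset_def r_coset_def)

lemma (in group) mem_normalizer_iff:
  assumes "H \<subseteq> carrier G"
  shows "g \<in> normalizer G H \<longleftrightarrow> g \<in> carrier G \<and> (\<lambda>x. g \<otimes> x \<otimes> inv g) ` H = H"
  using assms by (simp add: normalizer_def stabilizer_def conj_coset_eq_image)

lemma (in group) conj_mult_distrib:
  "g \<in> carrier G \<Longrightarrow> u \<in> carrier G \<Longrightarrow> v \<in> carrier G \<Longrightarrow>
     g \<otimes> (u \<otimes> v) \<otimes> inv g = (g \<otimes> u \<otimes> inv g) \<otimes> (g \<otimes> v \<otimes> inv g)"
  by (simp add: m_assoc flip: m_assoc[of "inv g" g])

lemma (in group) conj_inj_on: "g \<in> carrier G \<Longrightarrow> H \<subseteq> carrier G \<Longrightarrow> inj_on (\<lambda>x. g \<otimes> x \<otimes> inv g) H"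
  by (rule inj_onI) (auto simp: subset_iff)

lemma (in group) mem_normalizerI:
  assumes "finite (carrier G)" "H \<subseteq> carrier G" "g \<in> carrier G"
    and "\<And>x. x \<in> H \<Longrightarrow> g \<otimes> x \<otimes> inv g \<in> H"
  shows "g \<in> normalizer G H"
proof -
  have "(\<lambda>x. g \<otimes> x \<otimes> inv g) ` H = H"
    by (rule endo_inj_surj) (use assms finite_subset conj_inj_on in auto)
  then show ?thesis using assms by (simp add: mem_normalizer_iff)
qed

lemma (in group) subgroup_complement_mult:
  assumes "subgroup H G" "a \<in> H" "w \<in> carrier G - H"
  shows "a \<otimes> w \<in> carrier G - H" "w \<otimes> a \<in> carrier G - H"
proof -
  have a: "a \<in> carrier G" "inv a \<in> H"
    using assms by (auto simp: subgroup.mem_carrier subgroup.m_inv_closed)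
  have "inv a \<otimes> (a \<otimes> w) = w" "(w \<otimes> a) \<otimes> inv a = w"
    using a(1) assms(3) by (simp_all add: m_assoc flip: m_assoc[of "inv a"])
  then have "a \<otimes> w \<notin> H" "w \<otimes> a \<notin> H"
    using subgroup.m_closed[OF assms(1)] a(2) assms(3) by (metis DiffD2)+
  then show "a \<otimes> w \<in> carrier G - H" "w \<otimes> a \<in> carrier G - H"
    using a(1) assms(3) by auto
qed

text \<open>If \<open>p\<close> divides the index \<open>m\<close> of \<open>H\<close>, then it does not divide the number \<open>m - 1\<close> of cosets other
than \<open>H\<close>, so one of these is fixed by \<open>X\<close>.\<close>

lemma (in group) p_subgroup_conj_into_by_outsider:
  assumes fin: "finite (carrier G)" and p: "prime p" and H: "subgroup H G"
    and X: "subgroup X G" "X \<subseteq> H" "card X = p ^ k"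
    and m: "order G = card H * m" "p dvd m"
  shows "\<exists>w\<in>carrier G - H. \<forall>x\<in>X. w \<otimes> x \<otimes> inv w \<in> H"
proof -
  have Hs: "H \<subseteq> carrier G" using H subgroup.subset by blast
  have "m > 0" using m(1) fin order_gt_0_iff_finite by (metis mult_0_right neq0_conv)
  have m1: "\<not> p dvd m - 1"
  proof
    assume "p dvd m - 1"
    then have "p dvd 1" using m(2) \<open>m > 0\<close> by (metis One_nat_def Suc_leI dvd_diffD1)
    then show False using p by simp
  qed
  have cW: "card (carrier G - H) = card H * (m - 1)"
    using m Hs finite_subset[OF Hs fin] by (simp add: card_Diff_subset order_def right_diff_distrib')
  show ?thesis
  proof (rule p_subgroup_conj_into[OF fin p H X(1,3) Diff_subset _ _ cW m1])
    show "a \<otimes> w \<in> carrier G - H" if "a \<in> H" "w \<in> carrier G - H" for a w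
      using subgroup_complement_mult(1)[OF H] that .
    show "w \<otimes> a \<in> carrier G - H" if "w \<in> carrier G - H" "a \<in> X" for a w
      using subgroup_complement_mult(2)[OF H _ that(1)] that(2) X(2) by blast
  qed
qed

lemma (in group) p_group_normalizer_grows:
  assumes p: "prime p" and G: "order G = p ^ n" and P: "subgroup P G" "P \<noteq> carrier G"
  obtains g where "g \<in> normalizer G P" "g \<notin> P"
proof -
  have fin: "finite (carrier G)"
    using G p by (metis order_gt_0_iff_finite prime_gt_0_nat zero_less_power)
  have Ps: "P \<subseteq> carrier G" using P subgroup.subset by blast
  obtain j where j: "card P = p ^ j" using card_subgroup_p_power[OF is_group P(1) G p] .
  have "card P < card (carrier G)" using Ps P(2) fin by (simp add: psubset_card_mono psubsetI)
  then have "p ^ j < p ^ n" using j G by (simp add: order_def)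
  then have "j < n" using p by (simp add: prime_gt_Suc_0_nat)
  then have "order G = card P * p ^ (n - j)" "p dvd p ^ (n - j)"
    using G j by (simp_all add: dvd_power flip: power_add)
  from p_subgroup_conj_into_by_outsider[OF fin p P(1) P(1) subset_refl j this]
  show ?thesis using mem_normalizerI[OF fin Ps] that by blast
qed

lemma (in group) conj_preimage_subgroup:
  assumes "subgroup H G" "g \<in> carrier G"
  shows "subgroup {x \<in> carrier G. g \<otimes> x \<otimes> inv g \<in> H} G"
proof -
  have "x \<in> inv g <# H #> inv (inv g)" if x: "x \<in> carrier G" "g \<otimes> x \<otimes> inv g \<in> H" for x
  proof -
    have "x = inv g \<otimes> (g \<otimes> x \<otimes> inv g) \<otimes> inv (inv g)"
      using assms(2) x(1) by (simp add: m_assoc inv_solve_left)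
    then show ?thesis using x(2) unfolding conj_coset_eq_image by blast
  qed
  moreover have "h \<in> carrier G" "g \<otimes> (inv g \<otimes> h \<otimes> inv (inv g)) \<otimes> inv g \<in> H" if "h \<in> H" for h
    using that conjugation_is_surj[OF assms(2), of h] subgroup.mem_carrier[OF assms(1) that] assms(2)
    by auto
  ultimately have "{x \<in> carrier G. g \<otimes> x \<otimes> inv g \<in> H} = inv g <# H #> inv (inv g)"
    unfolding conj_coset_eq_image using assms(2) by blast
  then show ?thesis using subgroup_conjugation_is_surj2[OF inv_closed] assms by metis
qed

lemma (in group) card_subgroup_dvd:
  assumes "subgroup Q G" "subgroup K G" "Q \<subseteq> K"
  shows "card Q dvd card K"
proof -
  have "card (rcosets\<^bsub>G\<lparr>carrier := K\<rparr>\<^esub> Q) * card Q = card K"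
    using group.lagrange[OF subgroup_imp_group[OF assms(2)] subgroup_incl[OF assms]]
    by (simp add: order_def)
  then show ?thesis by (metis dvd_triv_right)
qed

section \<open>Strongly embedded subgroups\<close>

text \<open>A strongly \<open>p\<close>-embedded subgroup \<open>H\<close> has index prime to \<open>p\<close>, so it contains a conjugate of the normal
\<open>p\<close>-subgroup \<open>N\<close>, hence \<open>N\<close> itself and likewise \<open>N \<le> H \<inter> g H g\<^sup>-\<^sup>1\<close> for every \<open>g\<close>. For \<open>g\<close> outside \<open>H\<close>
this intersection has order prime to \<open>p\<close>.\<close>

lemma (in group) strongly_embedded_normal_p_subgroup:
  assumes p: "prime p" and fin: "finite (carrier G)"
    and H: "strongly_embedded p H G"
    and N: "N \<lhd> G" "card N = p ^ k"
  shows "card N = 1"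
proof (rule ccontr)
  assume "card N \<noteq> 1"
  have HG: "subgroup H G" "H \<noteq> carrier G" "p dvd card H"
    and emb: "\<And>g. g \<in> carrier G \<Longrightarrow> g \<notin> H \<Longrightarrow> \<not> p dvd card (H \<inter> (\<lambda>x. g \<otimes> x \<otimes> inv g) ` H)"
    using H by (auto simp: strongly_embedded_def conj_coset_eq_image)
  have Hs: "H \<subseteq> carrier G" using HG(1) subgroup.subset by blast
  have finH: "finite H" using Hs fin finite_subset by blast
  obtain m where m: "order G = card H * m"
    using lagrange[OF HG(1)] by (metis mult.commute)
  have p_div: "p dvd card (H \<inter> (\<lambda>x. g \<otimes> x \<otimes> inv g) ` H)"
    if g: "g \<in> carrier G" and Q: "subgroup Q G" "p dvd card Q" "Q \<subseteq> H"
      and sub: "\<And>x. x \<in> Q \<Longrightarrow> inv g \<otimes> x \<otimes> g \<in> H" for g Q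
  proof -
    have "x \<in> (\<lambda>x. g \<otimes> x \<otimes> inv g) ` H" if "x \<in> Q" for x
      using imageI[OF sub[OF that], of "\<lambda>x. g \<otimes> x \<otimes> inv g"]
        conjugation_is_surj[OF g subgroup.mem_carrier[OF Q(1) that]] by simp
    then have "Q \<subseteq> H \<inter> (\<lambda>x. g \<otimes> x \<otimes> inv g) ` H" using Q(3) by blast
    moreover have "subgroup (H \<inter> (\<lambda>x. g \<otimes> x \<otimes> inv g) ` H) G"
      using subgroups_Inter_pair HG(1) subgroup_conjugation_is_surj2[OF g HG(1)]
      by (simp add: conj_coset_eq_image)
    ultimately have "card Q dvd card (H \<inter> (\<lambda>x. g \<otimes> x \<otimes> inv g) ` H)"
      using card_subgroup_dvd Q(1) by blast
    then show ?thesis using Q(2) dvd_trans by blast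
  qed
  \<comment> \<open>A subgroup of order \<open>p\<close> in \<open>H\<close> would otherwise be conjugated into \<open>H\<close> from outside.\<close>
  have index: "\<not> p dvd m"
  proof
    assume pm: "p dvd m"
    obtain j where "order (G\<lparr>carrier := H\<rparr>) = p ^ 1 * j" using HG(3) by (auto simp: order_def)
    from sylow_thm[OF p subgroup_imp_group[OF HG(1)] this]
    obtain Q where Q: "subgroup Q (G\<lparr>carrier := H\<rparr>)" "card Q = p ^ 1"
      using finH by auto
    have QG: "subgroup Q G" by (rule incl_subgroup[OF HG(1) Q(1)])
    have QH: "Q \<subseteq> H" using subgroup.subset[OF Q(1)] by simp
    obtain w where w: "w \<in> carrier G - H" "\<And>x. x \<in> Q \<Longrightarrow> w \<otimes> x \<otimes> inv w \<in> H"
      using p_subgroup_conj_into_by_outsider[OF fin p HG(1) QG QH Q(2) m pm] by blast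
    have iw: "inv w \<in> carrier G" "inv (inv w) = w" using w(1) by auto
    have "p dvd card (H \<inter> (\<lambda>x. inv w \<otimes> x \<otimes> inv (inv w)) ` H)"
    proof (rule p_div[OF iw(1) QG _ QH])
      show "p dvd card Q" using Q(2) by simp
      show "inv (inv w) \<otimes> x \<otimes> inv w \<in> H" if "x \<in> Q" for x
        using w(2)[OF that] iw(2) by simp
    qed
    moreover have "inv w \<notin> H"
      using w(1) iw(2) subgroup.m_inv_closed[OF HG(1), of "inv w"] by auto
    ultimately show False using emb[OF iw(1)] by simp
  qed
  have NG: "subgroup N G" using N(1) by (simp add: normal_imp_subgroup)
  have conjN: "g \<otimes> x \<otimes> inv g \<in> N" if "g \<in> carrier G" "x \<in> N" for g x
    using N(1) that by (simp add: normal.inv_op_closed2)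
  obtain w where w: "w \<in> carrier G" "\<And>x. x \<in> N \<Longrightarrow> w \<otimes> x \<otimes> inv w \<in> H"
  proof -
    have "\<exists>w\<in>carrier G. \<forall>x\<in>N. w \<otimes> x \<otimes> inv w \<in> H"
    proof (rule p_subgroup_conj_into[OF fin p HG(1) NG N(2) subset_refl])
      show "card (carrier G) = card H * m" using m by (simp add: order_def)
    qed (use index subgroup.mem_carrier[OF HG(1)] subgroup.mem_carrier[OF NG] in simp_all)
    then show ?thesis using that by blast
  qed
  have NH: "N \<subseteq> H"
  proof
    fix x assume x: "x \<in> N"
    then have "inv w \<otimes> x \<otimes> w \<in> N" using conjN[of "inv w"] w by simp
    from w(2)[OF this] show "x \<in> H"
      using conjugation_is_surj[OF w(1)] x subgroup.mem_carrier[OF NG] by simp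
  qed
  obtain g where g: "g \<in> carrier G" "g \<notin> H" using Hs HG(2) by blast
  have "p dvd card (H \<inter> (\<lambda>x. g \<otimes> x \<otimes> inv g) ` H)"
  proof (rule p_div[OF g(1) NG _ NH])
    show "p dvd card N" using N(2) \<open>card N \<noteq> 1\<close> by (cases k) auto
    show "inv g \<otimes> x \<otimes> g \<in> H" if "x \<in> N" for x
      using conjN[of "inv g" x] that g(1) NH by auto
  qed
  then show False using emb[OF g] by contradiction
qed

lemma (in group_hom) card_image_dvd_order: "card (h ` carrier G) dvd order G"
proof -
  interpret img: group_hom G "H\<lparr>carrier := h ` carrier G\<rparr>" h
    using induced_group_hom[OF G.subgroup_self] by simp
  have "(\<lambda>X. the_elem (h ` X)) \<in> iso (G Mod kernel G (H\<lparr>carrier := h ` carrier G\<rparr>) h) (H\<lparr>carrier := h ` carrier G\<rparr>)"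
    by (rule img.FactGroup_iso_set) simp
  then have "card (rcosets (kernel G (H\<lparr>carrier := h ` carrier G\<rparr>) h)) = card (h ` carrier G)"
    by (auto simp: iso_def FactGroup_def dest: bij_betw_same_card)
  then show ?thesis
    using G.lagrange[OF img.subgroup_kernel] by (metis dvd_triv_left)
qed

lemma (in group) quotient_map_hom:
  assumes "I \<lhd> G"
  shows "group_hom G (G Mod I) (\<lambda>a. I #> a)"
  unfolding group_hom_def group_hom_axioms_def
  using normal.factorgroup_is_group[OF assms] normal.r_coset_hom_Mod[OF assms] is_group by blast

lemma (in group) card_quotient_image:
  assumes "I \<lhd> G" "subgroup K G" "I \<subseteq> K"
  shows "card ((\<lambda>a. I #> a) ` K) * card I = card K"
proof -
  have "rcosets\<^bsub>G\<lparr>carrier := K\<rparr>\<^esub> I = (\<lambda>a. I #> a) ` K"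
    by (auto simp: RCOSETS_def r_coset_def)
  then show ?thesis
    using group.lagrange[OF subgroup_imp_group[OF assms(2)]
        subgroup_incl[OF normal_imp_subgroup[OF assms(1)] assms(2,3)]]
    by (simp add: order_def)
qed

lemma (in group) r_coset_eq_imp_mem:
  assumes "I \<lhd> G" "I \<subseteq> K" "subgroup K G" "k \<in> K" "g \<in> carrier G" "I #> g = I #> k"
  shows "g \<in> K"
proof -
  have "g \<in> I #> k"
    using rcos_self[OF assms(5) normal_imp_subgroup[OF assms(1)]] assms(6) by simp
  then show ?thesis
    using assms(2,4) subgroup.m_closed[OF assms(3)] by (auto simp: r_coset_def)
qed

text \<open>In the application \<open>G = Aut\<^sub>F(Q)\<close> and \<open>I = Inn(Q)\<close>: the conclusion is \<open>O\<^sub>p(Out\<^sub>F(Q)) = 1\<close>, phrased in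
the group \<open>Aut\<^sub>F(Q)\<close>.\<close>

lemma (in group) strongly_embedded_quotient_normal_p_subgroup:
  assumes p: "prime p" and fin: "finite (carrier G)"
    and I: "I \<lhd> G" and H: "strongly_embedded p H (G Mod I)"
    and N: "N \<lhd> G" "I \<subseteq> N" "card N = p ^ k"
  shows "N = I"
proof -
  interpret \<pi>: group_hom G "G Mod I" "\<lambda>a. I #> a" by (rule quotient_map_hom[OF I])
  let ?N = "(\<lambda>a. I #> a) ` N"
  have NG: "subgroup N G" by (rule normal_imp_subgroup[OF N(1)])
  have "?N \<lhd> G Mod I"
    using normal.surj_hom_normal_subgroup[OF N(1) \<pi>.group_hom_axioms] by (simp add: carrier_FactGroup)
  moreover have c: "card ?N * card I = card N"
    by (rule card_quotient_image[OF I NG N(2)])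
  moreover obtain j where "card ?N = p ^ j"
    using c N(3) p by (metis divides_primepow_nat dvd_triv_left)
  moreover have "finite (carrier (G Mod I))" using fin by (simp add: carrier_FactGroup)
  ultimately have "card ?N = 1"
    using group.strongly_embedded_normal_p_subgroup[OF \<pi>.H.is_group p _ H] by blast
  then have "card I = card N" using c by simp
  moreover have "finite N" using subgroup.subset[OF NG] fin finite_subset by blast
  ultimately show ?thesis using N(2) card_subset_eq by metis
qed

text \<open>A criterion for \<open>H / I\<close> to be strongly \<open>p\<close>-embedded that mentions only subgroups of one Sylow
\<open>p\<close>-subgroup \<open>P\<close> of \<open>G\<close> inside \<open>H\<close>, and no quotient: \<open>H\<close> has to contain every element that conjugates
a subgroup of \<open>P\<close> larger than \<open>I\<close> into \<open>P\<close>. Suppose that \<open>p\<close> divides the order of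
\<open>H/I \<inter> (H/I)\<^sup>g\<close>. Then \<open>H \<inter> g H g\<^sup>-\<^sup>1\<close> has a \<open>p\<close>-subgroup \<open>Y\<close> of order \<open>p |I|\<close>. Sylow's theorem in \<open>H\<close>
conjugates \<open>Y\<close> by some \<open>h\<close> and \<open>g\<^sup>-\<^sup>1 Y g\<close> by some \<open>h'\<close> into \<open>P\<close>, and then \<open>h' g\<^sup>-\<^sup>1 h\<^sup>-\<^sup>1\<close> is an element
of the kind that lies in \<open>H\<close>; so \<open>g\<close> lies in \<open>H\<close>. The subgroup \<open>Y\<close> is compared with \<open>I\<close> by order,
since it need not contain \<open>I\<close>.\<close>

lemma (in group) strongly_embedded_quotientI:
  assumes p: "prime p" and fin: "finite (carrier G)"
    and I: "I \<lhd> G" "card I = p ^ i"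
    and H: "subgroup H G" "I \<subseteq> H" "H \<noteq> carrier G"
    and P: "subgroup P G" "P \<subseteq> H" "card P = p ^ multiplicity p (order G)" "card I < card P"
    and ctrl: "\<And>k Y. k \<in> carrier G \<Longrightarrow> subgroup Y G \<Longrightarrow> Y \<subseteq> P \<Longrightarrow> card I < card Y \<Longrightarrow>
                 (\<And>y. y \<in> Y \<Longrightarrow> k \<otimes> y \<otimes> inv k \<in> P) \<Longrightarrow> k \<in> H"
  shows "strongly_embedded p ((\<lambda>a. I #> a) ` H) (G Mod I)"
proof -
  interpret \<pi>: group_hom G "G Mod I" "\<lambda>a. I #> a" by (rule quotient_map_hom[OF I(1)])
  let ?\<pi> = "\<lambda>a. I #> a"
  have Hs: "H \<subseteq> carrier G" by (rule subgroup.subset[OF H(1)])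
  have IG: "subgroup I G" by (rule normal_imp_subgroup[OF I(1)])
  have ppos: "p > 0" using p prime_gt_0_nat by blast
  have sub: "subgroup (?\<pi> ` H) (G Mod I)" by (rule \<pi>.subgroup_img_is_subgroup[OF H(1)])
  have mem_img: "g \<in> H" if "g \<in> carrier G" "I #> g \<in> ?\<pi> ` H" for g
    using r_coset_eq_imp_mem[OF I(1) H(2,1) _ that(1)] that(2) by blast
  have proper: "?\<pi> ` H \<noteq> carrier (G Mod I)"
  proof
    assume "?\<pi> ` H = carrier (G Mod I)"
    then have "carrier G \<subseteq> H" using mem_img by (auto simp: carrier_FactGroup)
    then show False using Hs H(3) by blast
  qed
  \<comment> \<open>Divisibility in the quotient is read off upstairs, where \<open>I\<close> contributes \<open>p ^ i\<close>.\<close>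
  have cancel: "p dvd card (?\<pi> ` K) \<longleftrightarrow> p ^ Suc i dvd card K"
    if "subgroup K G" "I \<subseteq> K" for K
    unfolding card_quotient_image[OF I(1) that, symmetric] I(2) using ppos by simp
  have "p ^ Suc i dvd card P"
    using P(3,4) I(2) p by (metis le_imp_power_dvd Suc_leI power_less_imp_less_exp prime_gt_1_nat)
  then have "p ^ Suc i dvd card H"
    using card_subgroup_dvd[OF P(1) H(1) P(2)] dvd_trans by blast
  then have div: "p dvd card (?\<pi> ` H)" using cancel[OF H(1,2)] by simp
  have sylH: "\<exists>h\<in>H. \<forall>y\<in>Y. h \<otimes> y \<otimes> inv h \<in> P"
    if Y: "subgroup Y G" "Y \<subseteq> H" "card Y = p ^ Suc i" for Y
  proof -
    let ?H = "G\<lparr>carrier := H\<rparr>"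
    have "order G \<noteq> 0" using fin order_gt_0_iff_finite by simp
    moreover have dvd: "card H dvd order G" using lagrange[OF H(1)] by (metis dvd_triv_right)
    ultimately have pos: "order G \<noteq> 0" "card H \<noteq> 0" by auto
    have "multiplicity p (card H) \<le> multiplicity p (order G)"
      by (rule dvd_imp_multiplicity_le[OF dvd pos(1)])
    moreover have "multiplicity p (order G) \<le> multiplicity p (card H)"
      using card_subgroup_dvd[OF P(1) H(1) P(2)] P(3) pos(2) p
      by (metis multiplicity_geI not_prime_unit)
    ultimately have "card P = p ^ multiplicity p (order ?H)" using P(3) by (simp add: order_def)
    then have "\<exists>h\<in>carrier ?H. \<forall>y\<in>Y. h \<otimes>\<^bsub>?H\<^esub> y \<otimes>\<^bsub>?H\<^esub> inv\<^bsub>?H\<^esub> h \<in> P"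
      using group.sylow_conj_into[OF subgroup_imp_group[OF H(1)] _ p
          subgroup_incl[OF P(1) H(1) P(2)] _ subgroup_incl[OF Y(1) H(1) Y(2)] Y(3)]
        finite_subset[OF Hs fin] by simp
    then show ?thesis using H(1) by auto
  qed
  have "\<not> p dvd card (?\<pi> ` H \<inter> (C <#\<^bsub>G Mod I\<^esub> ?\<pi> ` H #>\<^bsub>G Mod I\<^esub> inv\<^bsub>G Mod I\<^esub> C))"
    if C: "C \<in> carrier (G Mod I) - ?\<pi> ` H" for C
  proof
    assume dvd: "p dvd card (?\<pi> ` H \<inter> (C <#\<^bsub>G Mod I\<^esub> ?\<pi> ` H #>\<^bsub>G Mod I\<^esub> inv\<^bsub>G Mod I\<^esub> C))"
    obtain g where g: "g \<in> carrier G" "C = I #> g" "g \<notin> H"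
      using C by (auto simp: carrier_FactGroup)
    let ?K = "H \<inter> {x \<in> carrier G. inv g \<otimes> x \<otimes> inv (inv g) \<in> H}"
    have K: "subgroup ?K G"
      using subgroups_Inter_pair[OF H(1) conj_preimage_subgroup[OF H(1) inv_closed[OF g(1)]]] .
    have IK: "I \<subseteq> ?K"
      using H(2) subgroup.mem_carrier[OF IG] normal.inv_op_closed2[OF I(1), of "inv g"] g(1) by auto
    have "?\<pi> ` H \<inter> (C <#\<^bsub>G Mod I\<^esub> ?\<pi> ` H #>\<^bsub>G Mod I\<^esub> inv\<^bsub>G Mod I\<^esub> C) \<subseteq> ?\<pi> ` ?K"
    proof
      fix D assume D: "D \<in> ?\<pi> ` H \<inter> (C <#\<^bsub>G Mod I\<^esub> ?\<pi> ` H #>\<^bsub>G Mod I\<^esub> inv\<^bsub>G Mod I\<^esub> C)"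
      then obtain x where x: "x \<in> H" "D = ?\<pi> x" by blast
      obtain h where h: "h \<in> H" "D = C \<otimes>\<^bsub>G Mod I\<^esub> ?\<pi> h \<otimes>\<^bsub>G Mod I\<^esub> inv\<^bsub>G Mod I\<^esub> C"
        using D unfolding \<pi>.H.conj_coset_eq_image by blast
      have hc: "h \<in> carrier G" and xc: "x \<in> carrier G" using h x Hs by auto
      have "D = ?\<pi> (g \<otimes> h \<otimes> inv g)"
        unfolding h(2) g(2) using g(1) hc by (simp only: \<pi>.hom_mult \<pi>.hom_inv m_closed inv_closed)
      then have "?\<pi> (inv g \<otimes> x \<otimes> g) = ?\<pi> (inv g \<otimes> (g \<otimes> h \<otimes> inv g) \<otimes> g)"
        using x(2)[symmetric] g(1) hc xc by (simp only: \<pi>.hom_mult m_closed inv_closed)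
      also have "inv g \<otimes> (g \<otimes> h \<otimes> inv g) \<otimes> g = h"
        using conjugation_is_surj[of "inv g" h] g(1) hc by simp
      finally have "inv g \<otimes> x \<otimes> g \<in> H"
        using mem_img[of "inv g \<otimes> x \<otimes> g"] g(1) xc h(1) by blast
      then show "D \<in> ?\<pi> ` ?K" using x xc g(1) by simp
    qed
    moreover have "?\<pi> ` ?K \<subseteq> ?\<pi> ` H \<inter> (C <#\<^bsub>G Mod I\<^esub> ?\<pi> ` H #>\<^bsub>G Mod I\<^esub> inv\<^bsub>G Mod I\<^esub> C)"
    proof
      fix D assume "D \<in> ?\<pi> ` ?K"
      then obtain x where "x \<in> ?K" and D: "D = ?\<pi> x" by blast
      then have x: "x \<in> H" "inv g \<otimes> x \<otimes> g \<in> H" "D = ?\<pi> x" "x \<in> carrier G"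
        using inv_inv[OF g(1)] by simp_all
      have "?\<pi> x = ?\<pi> (g \<otimes> (inv g \<otimes> x \<otimes> g) \<otimes> inv g)"
        using conjugation_is_surj[OF g(1) x(4)] by simp
      also have "\<dots> = C \<otimes>\<^bsub>G Mod I\<^esub> ?\<pi> (inv g \<otimes> x \<otimes> g) \<otimes>\<^bsub>G Mod I\<^esub> inv\<^bsub>G Mod I\<^esub> C"
        unfolding g(2) using g(1) x(4) by (simp only: \<pi>.hom_mult \<pi>.hom_inv m_closed inv_closed)
      finally show "D \<in> ?\<pi> ` H \<inter> (C <#\<^bsub>G Mod I\<^esub> ?\<pi> ` H #>\<^bsub>G Mod I\<^esub> inv\<^bsub>G Mod I\<^esub> C)"
        unfolding \<pi>.H.conj_coset_eq_image D using x(1,2) by blast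
    qed
    ultimately have "?\<pi> ` H \<inter> (C <#\<^bsub>G Mod I\<^esub> ?\<pi> ` H #>\<^bsub>G Mod I\<^esub> inv\<^bsub>G Mod I\<^esub> C) = ?\<pi> ` ?K"
      by (rule subset_antisym)
    then have "p ^ Suc i dvd card ?K" using dvd cancel[OF K IK] by argo
    then obtain m where m: "order (G\<lparr>carrier := ?K\<rparr>) = p ^ Suc i * m" by (auto simp: order_def)
    obtain Y where Y: "subgroup Y (G\<lparr>carrier := ?K\<rparr>)" "card Y = p ^ Suc i"
      using sylow_thm[OF p subgroup_imp_group[OF K] m] finite_subset[OF subgroup.subset[OF K] fin]
      by auto
    have YG: "subgroup Y G" and YK: "Y \<subseteq> ?K"
      using incl_subgroup[OF K Y(1)] subgroup.subset[OF Y(1)] by auto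
    have Yc: "y \<in> carrier G" if "y \<in> Y" for y using YK that by blast
    obtain h where h: "h \<in> H" "\<forall>y\<in>Y. h \<otimes> y \<otimes> inv h \<in> P"
      using sylH[OF YG _ Y(2)] YK by auto
    let ?Yg = "(\<lambda>y. inv g \<otimes> y \<otimes> inv (inv g)) ` Y"
    have "subgroup ?Yg G" "card ?Yg = p ^ Suc i"
      using subgroup_conjugation_is_surj2[OF inv_closed[OF g(1)] YG] Y(2)
        card_image[OF conj_inj_on[OF inv_closed[OF g(1)] subgroup.subset[OF YG]]]
      by (simp_all only: conj_coset_eq_image)
    moreover have "?Yg \<subseteq> H" using YK by blast
    ultimately obtain h' where h': "h' \<in> H" "\<forall>y\<in>?Yg. h' \<otimes> y \<otimes> inv h' \<in> P"
      using sylH by metis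
    let ?Y = "(\<lambda>y. h \<otimes> y \<otimes> inv h) ` Y"
    have hc: "h \<in> carrier G" "h' \<in> carrier G" using h(1) h'(1) Hs by auto
    \<comment> \<open>This element conjugates \<open>h Y h\<^sup>-\<^sup>1 \<le> P\<close> to \<open>h' (g\<^sup>-\<^sup>1 Y g) h'\<^sup>-\<^sup>1 \<le> P\<close>.\<close>
    have "h' \<otimes> inv g \<otimes> inv h \<in> H"
    proof (rule ctrl[of _ ?Y])
      show "h' \<otimes> inv g \<otimes> inv h \<in> carrier G" using hc g by simp
      show "subgroup ?Y G"
        using subgroup_conjugation_is_surj2[OF hc(1) YG] by (simp only: conj_coset_eq_image)
      show "?Y \<subseteq> P" using h(2) by blast
      have "card ?Y = p ^ Suc i"
        using card_image[OF conj_inj_on[OF hc(1) subgroup.subset[OF YG]]] Y(2) by simp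
      then show "card I < card ?Y" using I(2) prime_gt_1_nat[OF p] by simp
      fix z assume "z \<in> ?Y"
      then obtain y where y: "y \<in> Y" "z = h \<otimes> y \<otimes> inv h" by blast
      have zc: "z \<in> carrier G" using y(2) hc(1) Yc[OF y(1)] by simp
      have "(h' \<otimes> inv g \<otimes> inv h) \<otimes> z \<otimes> inv (h' \<otimes> inv g \<otimes> inv h)
          = h' \<otimes> (inv g \<otimes> (inv h \<otimes> z \<otimes> h) \<otimes> inv (inv g)) \<otimes> inv h'"
        using hc g(1) zc by (simp add: inv_mult_group m_assoc)
      also have "inv h \<otimes> z \<otimes> h = y"
        using conjugation_is_surj[of "inv h" y] hc(1) Yc[OF y(1)] y(2) by simp
      finally show "(h' \<otimes> inv g \<otimes> inv h) \<otimes> z \<otimes> inv (h' \<otimes> inv g \<otimes> inv h) \<in> P"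
        using h'(2) y(1) by simp
    qed
    from subgroup.m_closed[OF H(1) subgroup.m_closed[OF H(1) subgroup.m_inv_closed[OF H(1) h'(1)] this] h(1)]
    have "inv h' \<otimes> (h' \<otimes> inv g \<otimes> inv h) \<otimes> h \<in> H" .
    moreover have "inv h' \<otimes> (h' \<otimes> inv g \<otimes> inv h) \<otimes> h = inv g"
    proof -
      have "inv h' \<otimes> (h' \<otimes> inv g \<otimes> inv h) = inv g \<otimes> inv h"
        using hc g(1) by (simp add: m_assoc flip: m_assoc[of "inv h'" h'])
      then show ?thesis using hc g(1) by (simp add: m_assoc)
    qed
    ultimately have "inv (inv g) \<in> H" using subgroup.m_inv_closed[OF H(1)] by metis
    then show False using g by simp
  qed
  then show ?thesis unfolding strongly_embedded_def using sub proper div by blast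
qed

section \<open>Morphisms of a fusion system\<close>

sublocale fusion_system \<subseteq> group "fgrp E"
  by (rule group_fgrp)

context fusion_system
begin

lemma finite_fgrp: "finite (carrier (fgrp E))"
  using p_group_fgrp prime_p order_gt_0_iff_finite by (metis prime_gt_0_nat zero_less_power)

lemma finite_subgroup: "subgroup U (fgrp E) \<Longrightarrow> finite U"
  using finite_fgrp finite_subset subgroup.subset by metis

lemma card_subgroup_prime_power:
  assumes "subgroup U (fgrp E)"
  obtains j where "card U = p ^ j"
  using p_group_fgrp card_subgroup_p_power[OF is_group assms _ prime_p] by blast

lemma fhom_subgroup:
  assumes "\<phi> \<in> fhom E U V"
  shows "subgroup U (fgrp E)" "subgroup V (fgrp E)"
  using fhom_objects[OF assms] by auto

lemma fhom_ext: "\<phi> \<in> fhom E U V \<Longrightarrow> \<phi> \<in> extensional U"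
  and fhom_inj: "\<phi> \<in> fhom E U V \<Longrightarrow> inj_on \<phi> U"
  using fhom_inj_hom by blast+

lemma fhom_mem: "\<phi> \<in> fhom E U V \<Longrightarrow> x \<in> U \<Longrightarrow> \<phi> x \<in> V"
  using fhom_inj_hom[of \<phi> U V] by (auto simp: hom_def)

lemma fhom_mult:
  "\<phi> \<in> fhom E U V \<Longrightarrow> x \<in> U \<Longrightarrow> y \<in> U \<Longrightarrow>
     \<phi> (x \<otimes>\<^bsub>fgrp E\<^esub> y) = \<phi> x \<otimes>\<^bsub>fgrp E\<^esub> \<phi> y"
  using fhom_inj_hom[of \<phi> U V] by (auto simp: hom_def)

lemma fhom_inv:
  assumes "\<phi> \<in> fhom E U V" "x \<in> U"
  shows "\<phi> (inv\<^bsub>fgrp E\<^esub> x) = inv\<^bsub>fgrp E\<^esub> (\<phi> x)"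
proof -
  note U = fhom_subgroup(1)[OF assms(1)] and V = fhom_subgroup(2)[OF assms(1)]
  have "group_hom (fgrp E\<lparr>carrier := U\<rparr>) (fgrp E\<lparr>carrier := V\<rparr>) \<phi>"
    using fhom_inj_hom[OF assms(1)] U V
    by (simp add: group_hom_def group_hom_axioms_def subgroup_imp_group)
  from group_hom.hom_inv[OF this, of x] show ?thesis
    using assms U V fhom_mem[OF assms] by simp
qed

lemma fhom_conj:
  assumes "\<phi> \<in> fhom E U V" "g \<in> U" "x \<in> U"
  shows "\<phi> (g \<otimes>\<^bsub>fgrp E\<^esub> x \<otimes>\<^bsub>fgrp E\<^esub> inv\<^bsub>fgrp E\<^esub> g)
     = \<phi> g \<otimes>\<^bsub>fgrp E\<^esub> \<phi> x \<otimes>\<^bsub>fgrp E\<^esub> inv\<^bsub>fgrp E\<^esub> (\<phi> g)"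
  using fhom_subgroup(1)[OF assms(1)] assms
  by (simp add: fhom_mult fhom_inv subgroup.m_closed subgroup.m_inv_closed)

lemma conj_fhom:
  assumes "subgroup U (fgrp E)" "subgroup V (fgrp E)" "g \<in> carrier (fgrp E)"
    and "\<And>x. x \<in> U \<Longrightarrow> g \<otimes>\<^bsub>fgrp E\<^esub> x \<otimes>\<^bsub>fgrp E\<^esub> inv\<^bsub>fgrp E\<^esub> g \<in> V"
  shows "conj_map (fgrp E) g U \<in> fhom E U V"
  using conj_in_fhom[OF assms(1-3)] assms(4) by (auto simp: conj_map_def)

lemma fhom_comp:
  "\<phi> \<in> fhom E U V \<Longrightarrow> \<psi> \<in> fhom E V W \<Longrightarrow> (\<lambda>x\<in>U. \<psi> (\<phi> x)) \<in> fhom E U W"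
  using fhom_compose[of \<phi> U V \<psi> W] by (simp add: compose_def)

lemma fhom_incl:
  assumes "subgroup U (fgrp E)" "subgroup V (fgrp E)" "U \<subseteq> V"
  shows "(\<lambda>x\<in>U. x) \<in> fhom E U V"
proof -
  have "conj_map (fgrp E) \<one>\<^bsub>fgrp E\<^esub> U = (\<lambda>x\<in>U. x)"
    using subgroup.mem_carrier[OF assms(1)] by (auto simp: conj_map_def fun_eq_iff)
  then show ?thesis
    using conj_in_fhom[OF assms(1,2) one_closed] assms(3) by auto
qed

lemma fhom_image_subgroup: "\<phi> \<in> fhom E U V \<Longrightarrow> subgroup (\<phi> ` U) (fgrp E)"
  using iso_onto_image fhom_subgroup(2) by (fastforce simp: fiso_def)

lemma fhom_restrict:
  assumes "\<phi> \<in> fhom E U V" "subgroup U' (fgrp E)" "U' \<subseteq> U"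
    and "subgroup V' (fgrp E)" "\<phi> ` U' \<subseteq> V'"
  shows "restrict \<phi> U' \<in> fhom E U' V'"
proof -
  have "(\<lambda>x\<in>U'. \<phi> ((\<lambda>x\<in>U'. x) x)) \<in> fhom E U' V"
    by (rule fhom_comp[OF fhom_incl[OF assms(2) fhom_subgroup(1)[OF assms(1)] assms(3)] assms(1)])
  also have "(\<lambda>x\<in>U'. \<phi> ((\<lambda>x\<in>U'. x) x)) = restrict \<phi> U'" by auto
  finally have r: "restrict \<phi> U' \<in> fhom E U' V" .
  have im: "restrict \<phi> U' ` U' = \<phi> ` U'" by auto
  have "restrict \<phi> U' \<in> fhom E U' (\<phi> ` U')"
    using iso_onto_image[OF r] im by (simp add: fiso_def)
  moreover have "(\<lambda>x\<in>\<phi> ` U'. x) \<in> fhom E (\<phi> ` U') V'"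
    using fhom_incl[OF _ assms(4,5)] fhom_image_subgroup[OF r] im by simp
  ultimately have "(\<lambda>x\<in>U'. (\<lambda>x\<in>\<phi> ` U'. x) (restrict \<phi> U' x)) \<in> fhom E U' V'"
    by (rule fhom_comp)
  also have "(\<lambda>x\<in>U'. (\<lambda>x\<in>\<phi> ` U'. x) (restrict \<phi> U' x)) = restrict \<phi> U'" by auto
  finally show ?thesis .
qed

lemma fhom_codomain:
  assumes "\<phi> \<in> fhom E U V" "subgroup V' (fgrp E)" "\<phi> ` U \<subseteq> V'"
  shows "\<phi> \<in> fhom E U V'"
  using fhom_restrict[OF assms(1) fhom_subgroup(1)[OF assms(1)] subset_refl assms(2,3)]
    extensional_restrict[OF fhom_ext[OF assms(1)]] by simp

lemma fhom_inverse:
  assumes "\<phi> \<in> fhom E U V" "\<phi> ` U = V"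
  obtains \<psi> where "\<psi> \<in> fhom E V U" "\<psi> ` V = U"
    "\<And>x. x \<in> U \<Longrightarrow> \<psi> (\<phi> x) = x" "\<And>y. y \<in> V \<Longrightarrow> \<phi> (\<psi> y) = y"
proof -
  obtain \<psi> where \<psi>: "\<psi> \<in> fhom E V U" "compose U \<psi> \<phi> = (\<lambda>x\<in>U. x)" "compose V \<phi> \<psi> = (\<lambda>y\<in>V. y)"
    using iso_onto_image[OF assms(1)] assms(2) by (auto simp: fiso_def)
  have 1: "\<psi> (\<phi> x) = x" if "x \<in> U" for x
    using fun_cong[OF \<psi>(2), of x] that by (simp add: compose_def)
  have 2: "\<phi> (\<psi> y) = y" if "y \<in> V" for y
    using fun_cong[OF \<psi>(3), of y] that by (simp add: compose_def)
  have "\<psi> ` V = U"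
    using 1 fhom_mem[OF assms(1)] fhom_mem[OF \<psi>(1)] by force
  then show ?thesis using that \<psi>(1) 1 2 by blast
qed

lemma fconj_iff: "fconj E U V \<longleftrightarrow> (\<exists>\<phi>\<in>fhom E U V. \<phi> ` U = V)"
proof
  assume "fconj E U V"
  then obtain \<phi> \<psi> where \<phi>: "\<phi> \<in> fhom E U V" "\<psi> \<in> fhom E V U" "compose V \<phi> \<psi> = (\<lambda>y\<in>V. y)"
    by (auto simp: fconj_def fiso_def)
  have "y \<in> \<phi> ` U" if "y \<in> V" for y
    using fun_cong[OF \<phi>(3), of y] fhom_mem[OF \<phi>(2) that] that imageI[of "\<psi> y" U \<phi>]
    by (simp add: compose_def)
  then have "\<phi> ` U = V" using fhom_mem[OF \<phi>(1)] by blast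
  then show "\<exists>\<phi>\<in>fhom E U V. \<phi> ` U = V" using \<phi>(1) by blast
qed (use iso_onto_image in \<open>auto simp: fconj_def\<close>)

lemma fconj_refl: "subgroup U (fgrp E) \<Longrightarrow> fconj E U U"
  unfolding fconj_iff by (rule bexI[OF _ fhom_incl[of U U]]) auto

lemma fconj_sym: "fconj E U V \<Longrightarrow> fconj E V U"
  unfolding fconj_iff by (metis fhom_inverse)

lemma fconj_trans:
  assumes "fconj E U V" "fconj E V W"
  shows "fconj E U W"
proof -
  obtain \<phi> \<psi> where \<phi>: "\<phi> \<in> fhom E U V" "\<phi> ` U = V" and \<psi>: "\<psi> \<in> fhom E V W" "\<psi> ` V = W"
    using assms by (auto simp: fconj_iff)
  have "(\<lambda>x\<in>U. \<psi> (\<phi> x)) ` U = W" using \<phi>(2) \<psi>(2) by force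
  then show ?thesis using fhom_comp[OF \<phi>(1) \<psi>(1)] unfolding fconj_iff by blast
qed

lemma fconj_card: "fconj E U V \<Longrightarrow> card U = card V"
  using card_image[OF fhom_inj] by (fastforce simp: fconj_iff)

lemma fconj_subgroup: "fconj E U V \<Longrightarrow> subgroup U (fgrp E) \<and> subgroup V (fgrp E)"
  using fhom_subgroup by (fastforce simp: fconj_iff)

lemma fhom_image_eq: "\<phi> \<in> fhom E Q Q \<Longrightarrow> \<phi> ` Q = Q"
  by (rule endo_inj_surj) (use fhom_mem fhom_inj finite_subgroup fhom_subgroup in auto)

section \<open>Automorphism groups\<close>

lemma carrier_faut [simp]: "carrier (faut E Q) = fhom E Q Q"
  by (simp add: faut_def)

lemma fhom_subset_Bij: "fhom E Q Q \<subseteq> Bij Q"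
proof
  fix \<alpha> assume "\<alpha> \<in> fhom E Q Q"
  then show "\<alpha> \<in> Bij Q"
    unfolding Bij_def bij_betw_def using fhom_ext fhom_inj fhom_image_eq by simp
qed

lemma mult_faut:
  "\<alpha> \<in> fhom E Q Q \<Longrightarrow> \<beta> \<in> fhom E Q Q \<Longrightarrow> \<alpha> \<otimes>\<^bsub>faut E Q\<^esub> \<beta> = (\<lambda>x\<in>Q. \<alpha> (\<beta> x))"
  using fhom_subset_Bij[of Q] by (auto simp: faut_def BijGroup_def compose_def)

lemma one_faut: "\<one>\<^bsub>faut E Q\<^esub> = (\<lambda>x\<in>Q. x)"
  by (simp add: faut_def BijGroup_def)

lemma group_faut:
  assumes "subgroup Q (fgrp E)"
  shows "group (faut E Q)"
proof (rule groupI)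
  show "\<one>\<^bsub>faut E Q\<^esub> \<in> carrier (faut E Q)"
    using fhom_incl[OF assms assms] by (simp add: one_faut)
  fix \<alpha> assume \<alpha>: "\<alpha> \<in> carrier (faut E Q)"
  show "\<one>\<^bsub>faut E Q\<^esub> \<otimes>\<^bsub>faut E Q\<^esub> \<alpha> = \<alpha>"
    using \<alpha> fhom_incl[OF assms assms] fhom_mem[of \<alpha> Q Q] extensional_arb[OF fhom_ext[of \<alpha> Q Q]]
    by (auto simp: one_faut mult_faut fun_eq_iff)
  obtain \<beta> where \<beta>: "\<beta> \<in> fhom E Q Q" "\<And>x. x \<in> Q \<Longrightarrow> \<beta> (\<alpha> x) = x"
    using fhom_inverse[OF \<alpha>[unfolded carrier_faut] fhom_image_eq[OF \<alpha>[unfolded carrier_faut]]]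
    by metis
  have "\<beta> \<otimes>\<^bsub>faut E Q\<^esub> \<alpha> = \<one>\<^bsub>faut E Q\<^esub>"
    using \<alpha> \<beta> by (auto simp: mult_faut one_faut)
  then show "\<exists>\<beta>\<in>carrier (faut E Q). \<beta> \<otimes>\<^bsub>faut E Q\<^esub> \<alpha> = \<one>\<^bsub>faut E Q\<^esub>"
    using \<beta>(1) by auto
  fix \<gamma> assume \<gamma>: "\<gamma> \<in> carrier (faut E Q)"
  show "\<alpha> \<otimes>\<^bsub>faut E Q\<^esub> \<gamma> \<in> carrier (faut E Q)"
    using \<alpha> \<gamma> fhom_comp by (simp add: mult_faut)
  fix \<delta> assume \<delta>: "\<delta> \<in> carrier (faut E Q)"
  show "\<alpha> \<otimes>\<^bsub>faut E Q\<^esub> \<gamma> \<otimes>\<^bsub>faut E Q\<^esub> \<delta> = \<alpha> \<otimes>\<^bsub>faut E Q\<^esub> (\<gamma> \<otimes>\<^bsub>faut E Q\<^esub> \<delta>)"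
    using \<alpha> \<gamma> \<delta> fhom_comp fhom_mem by (auto simp: mult_faut)
qed

lemma finite_faut: "finite (carrier (faut E Q))"
proof (cases "fhom E Q Q = {}")
  case False
  then have "finite Q" using fhom_subgroup(1) finite_subgroup by blast
  moreover have "fhom E Q Q \<subseteq> Q \<rightarrow>\<^sub>E Q"
  proof (intro subsetI PiE_I)
    fix \<alpha> x assume \<alpha>: "\<alpha> \<in> fhom E Q Q"
    show "x \<in> Q \<Longrightarrow> \<alpha> x \<in> Q" by (rule fhom_mem[OF \<alpha>])
    show "x \<notin> Q \<Longrightarrow> \<alpha> x = undefined" by (rule extensional_arb[OF fhom_ext[OF \<alpha>]])
  qed
  ultimately show ?thesis using finite_PiE[of Q "\<lambda>_. Q"] finite_subset unfolding carrier_faut by blast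
qed simp

lemma inv_faut:
  assumes "\<alpha> \<in> fhom E Q Q"
  shows "inv\<^bsub>faut E Q\<^esub> \<alpha> \<in> fhom E Q Q"
    "x \<in> Q \<Longrightarrow> \<alpha> ((inv\<^bsub>faut E Q\<^esub> \<alpha>) x) = x" "x \<in> Q \<Longrightarrow> (inv\<^bsub>faut E Q\<^esub> \<alpha>) (\<alpha> x) = x"
proof -
  interpret A: group "faut E Q" using group_faut fhom_subgroup(1)[OF assms] .
  have \<alpha>: "\<alpha> \<in> carrier (faut E Q)" using assms by simp
  show i: "inv\<^bsub>faut E Q\<^esub> \<alpha> \<in> fhom E Q Q" using A.inv_closed[OF \<alpha>] by simp
  show "\<alpha> ((inv\<^bsub>faut E Q\<^esub> \<alpha>) x) = x" if "x \<in> Q"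
    using fun_cong[OF A.r_inv[OF \<alpha>], of x] that assms i by (simp add: mult_faut one_faut)
  show "(inv\<^bsub>faut E Q\<^esub> \<alpha>) (\<alpha> x) = x" if "x \<in> Q"
    using fun_cong[OF A.l_inv[OF \<alpha>], of x] that assms i by (simp add: mult_faut one_faut)
qed

lemma conj_faut:
  assumes "\<alpha> \<in> fhom E Q Q" "\<beta> \<in> fhom E Q Q"
  shows "\<alpha> \<otimes>\<^bsub>faut E Q\<^esub> \<beta> \<otimes>\<^bsub>faut E Q\<^esub> inv\<^bsub>faut E Q\<^esub> \<alpha> = (\<lambda>x\<in>Q. \<alpha> (\<beta> ((inv\<^bsub>faut E Q\<^esub> \<alpha>) x)))"
  using assms inv_faut[OF assms(1)] fhom_mem fhom_comp[OF assms(2,1)]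
  by (auto simp: mult_faut)

lemma mem_normalizer:
  assumes "subgroup Q (fgrp E)"
  shows "g \<in> normalizer (fgrp E) Q \<longleftrightarrow> g \<in> carrier (fgrp E) \<and>
    (\<forall>x\<in>Q. g \<otimes>\<^bsub>fgrp E\<^esub> x \<otimes>\<^bsub>fgrp E\<^esub> inv\<^bsub>fgrp E\<^esub> g \<in> Q)"
  using mem_normalizer_iff[OF subgroup.subset[OF assms]]
    mem_normalizerI[OF finite_fgrp subgroup.subset[OF assms]] by blast

lemma subgroup_normalizer:
  "subgroup Q (fgrp E) \<Longrightarrow> subgroup (normalizer (fgrp E) Q) (fgrp E)"
  by (rule normalizer_imp_subgroup[OF subgroup.subset])

lemma subset_normalizer: "subgroup Q (fgrp E) \<Longrightarrow> Q \<subseteq> normalizer (fgrp E) Q"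
  by (auto simp: mem_normalizer subgroup.mem_carrier subgroup.m_closed subgroup.m_inv_closed)

lemma conj_map_hom:
  assumes "subgroup Q (fgrp E)"
  shows "group_hom (fgrp E\<lparr>carrier := normalizer (fgrp E) Q\<rparr>) (faut E Q) (\<lambda>g. conj_map (fgrp E) g Q)"
proof -
  have mem: "conj_map (fgrp E) g Q \<in> fhom E Q Q" if "g \<in> normalizer (fgrp E) Q" for g
    using conj_fhom[OF assms assms] that by (simp add: mem_normalizer assms)
  have "conj_map (fgrp E) (g \<otimes>\<^bsub>fgrp E\<^esub> h) Q
      = conj_map (fgrp E) g Q \<otimes>\<^bsub>faut E Q\<^esub> conj_map (fgrp E) h Q"
    if g: "g \<in> normalizer (fgrp E) Q" and h: "h \<in> normalizer (fgrp E) Q" for g h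
  proof -
    have c: "g \<in> carrier (fgrp E)" "h \<in> carrier (fgrp E)"
      using g h by (auto simp: mem_normalizer assms)
    have "h \<otimes>\<^bsub>fgrp E\<^esub> x \<otimes>\<^bsub>fgrp E\<^esub> inv\<^bsub>fgrp E\<^esub> h \<in> Q" if "x \<in> Q" for x
      using h that by (simp add: mem_normalizer assms)
    then show ?thesis
      unfolding mult_faut[OF mem[OF g] mem[OF h]] using c subgroup.mem_carrier[OF assms]
      by (auto simp: conj_map_def fun_eq_iff inv_mult_group m_assoc)
  qed
  then show ?thesis
    unfolding group_hom_def group_hom_axioms_def
    using mem subgroup_imp_group[OF subgroup_normalizer[OF assms]] group_faut[OF assms]
    by (auto intro!: homI)
qed

lemma conj_map_mem_faut:
  "subgroup Q (fgrp E) \<Longrightarrow> g \<in> normalizer (fgrp E) Q \<Longrightarrow> conj_map (fgrp E) g Q \<in> fhom E Q Q"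
  using group_hom.hom_closed[OF conj_map_hom] by fastforce

lemma conj_map_image_subgroup:
  assumes "subgroup Q (fgrp E)" "subgroup M (fgrp E)" "M \<subseteq> normalizer (fgrp E) Q"
  shows "subgroup ((\<lambda>g. conj_map (fgrp E) g Q) ` M) (faut E Q)"
  by (rule group_hom.subgroup_img_is_subgroup[OF conj_map_hom[OF assms(1)]])
    (rule subgroup_incl[OF assms(2) subgroup_normalizer[OF assms(1)] assms(3)])

lemma card_conj_map_image:
  assumes "subgroup Q (fgrp E)" "subgroup M (fgrp E)" "M \<subseteq> normalizer (fgrp E) Q"
  obtains j where "card ((\<lambda>g. conj_map (fgrp E) g Q) ` M) = p ^ j"
proof -
  interpret h: group_hom "fgrp E\<lparr>carrier := M\<rparr>"
      "faut E Q\<lparr>carrier := (\<lambda>g. conj_map (fgrp E) g Q) ` M\<rparr>" "\<lambda>g. conj_map (fgrp E) g Q"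
    using group_hom.induced_group_hom[OF conj_map_hom[OF assms(1)]
        subgroup_incl[OF assms(2) subgroup_normalizer[OF assms(1)] assms(3)]] by simp
  obtain k where "card M = p ^ k" using card_subgroup_prime_power[OF assms(2)] .
  then show ?thesis
    using h.card_image_dvd_order that prime_p
    by (auto simp: order_def divides_primepow_nat)
qed


text \<open>If \<open>\<psi>\<close> extends \<open>\<alpha>\<close>, conjugating \<open>c\<^sub>g\<close> by \<open>\<alpha>\<close> gives \<open>c\<^bsub>\<psi>(g)\<^esub>\<close>. With \<open>\<psi> = \<alpha>\<close> this says that \<open>Inn(Q)\<close> is normal
in \<open>Aut(Q)\<close>; with \<open>\<psi>\<close> an automorphism of a larger group \<open>M\<close> it says that \<open>\<alpha>\<close> normalises \<open>Aut\<^sub>M(Q)\<close>.\<close>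

lemma conj_map_extension:
  assumes \<alpha>: "\<alpha> \<in> fhom E Q Q" and \<psi>: "\<psi> \<in> fhom E K L" and QK: "Q \<subseteq> K"
    and eq: "\<And>x. x \<in> Q \<Longrightarrow> \<psi> x = \<alpha> x" and g: "g \<in> K" "g \<in> normalizer (fgrp E) Q"
  shows "\<alpha> \<otimes>\<^bsub>faut E Q\<^esub> conj_map (fgrp E) g Q \<otimes>\<^bsub>faut E Q\<^esub> inv\<^bsub>faut E Q\<^esub> \<alpha>
     = conj_map (fgrp E) (\<psi> g) Q"
proof -
  note Q = fhom_subgroup(1)[OF \<alpha>]
  have "\<alpha> (conj_map (fgrp E) g Q ((inv\<^bsub>faut E Q\<^esub> \<alpha>) x))
      = \<psi> g \<otimes>\<^bsub>fgrp E\<^esub> x \<otimes>\<^bsub>fgrp E\<^esub> inv\<^bsub>fgrp E\<^esub> \<psi> g" if x: "x \<in> Q" for x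
  proof -
    let ?y = "(inv\<^bsub>faut E Q\<^esub> \<alpha>) x"
    have y: "?y \<in> Q" "\<alpha> ?y = x" using inv_faut[OF \<alpha>] x fhom_mem by blast+
    have "g \<otimes>\<^bsub>fgrp E\<^esub> ?y \<otimes>\<^bsub>fgrp E\<^esub> inv\<^bsub>fgrp E\<^esub> g \<in> Q"
      using g(2) y(1) by (simp add: mem_normalizer Q)
    then have "\<alpha> (conj_map (fgrp E) g Q ?y) = \<psi> (g \<otimes>\<^bsub>fgrp E\<^esub> ?y \<otimes>\<^bsub>fgrp E\<^esub> inv\<^bsub>fgrp E\<^esub> g)"
      using y(1) eq by (simp add: conj_map_def)
    also have "\<dots> = \<psi> g \<otimes>\<^bsub>fgrp E\<^esub> \<psi> ?y \<otimes>\<^bsub>fgrp E\<^esub> inv\<^bsub>fgrp E\<^esub> \<psi> g"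
      using fhom_conj[OF \<psi> g(1)] y(1) QK by blast
    finally show ?thesis using eq[OF y(1)] y(2) by simp
  qed
  then show ?thesis
    unfolding conj_faut[OF \<alpha> conj_map_mem_faut[OF Q g(2)]]
    by (auto simp: conj_map_def[of _ "\<psi> g"])
qed

lemma finn_normal:
  assumes "subgroup Q (fgrp E)"
  shows "finn E Q \<lhd> faut E Q"
proof -
  interpret A: group "faut E Q" by (rule group_faut[OF assms])
  show ?thesis
  proof (rule A.normal_invI)
    show "subgroup (finn E Q) (faut E Q)"
      unfolding finn_def by (rule conj_map_image_subgroup[OF assms assms subset_normalizer[OF assms]])
    fix \<alpha> \<beta> assume \<alpha>: "\<alpha> \<in> carrier (faut E Q)" and "\<beta> \<in> finn E Q"
    then obtain g where g: "g \<in> Q" "\<beta> = conj_map (fgrp E) g Q" by (auto simp: finn_def)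
    then show "\<alpha> \<otimes>\<^bsub>faut E Q\<^esub> \<beta> \<otimes>\<^bsub>faut E Q\<^esub> inv\<^bsub>faut E Q\<^esub> \<alpha> \<in> finn E Q"
      using conj_map_extension[of \<alpha> Q \<alpha> Q Q g] \<alpha> subset_normalizer[OF assms] fhom_mem[of \<alpha> Q Q g]
      by (auto simp: finn_def)
  qed
qed

lemma card_finn:
  assumes "subgroup Q (fgrp E)"
  obtains i where "card (finn E Q) = p ^ i"
  using card_conj_map_image[OF assms assms subset_normalizer[OF assms]] by (auto simp: finn_def)

lemma faut_grp_subgroup:
  "subgroup Q (fgrp E) \<Longrightarrow> subgroup (faut_grp E Q) (faut E Q)"
  unfolding faut_grp_def by (intro conj_map_image_subgroup subgroup_normalizer subset_refl)

lemma finn_subset_faut_grp: "subgroup Q (fgrp E) \<Longrightarrow> finn E Q \<subseteq> faut_grp E Q"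
  using subset_normalizer by (auto simp: finn_def faut_grp_def)

lemma fcentric_centralizer:
  assumes "subgroup Q (fgrp E)" "fcentric E Q"
  shows "centralizer (fgrp E) Q \<subseteq> Q"
proof -
  have "centralizer (fgrp E) Q = group_center (fgrp E\<lparr>carrier := Q\<rparr>)"
    using assms(2) fconj_refl[OF assms(1)] by (simp add: fcentric_def)
  then show ?thesis by (auto simp: group_center_def centralizer_def)
qed

text \<open>If \<open>g\<close> and \<open>q \<in> Q\<close> induce the same automorphism of \<open>Q\<close>, then \<open>q\<^sup>-\<^sup>1 g\<close> centralises \<open>Q\<close>, so it lies in
\<open>Q\<close> for a centric \<open>Q\<close>.\<close>

lemma fcentric_conj_map_finn:
  assumes Q: "subgroup Q (fgrp E)" "fcentric E Q"
    and g: "g \<in> carrier (fgrp E)" "conj_map (fgrp E) g Q \<in> finn E Q"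
  shows "g \<in> Q"
proof -
  obtain q where q: "q \<in> Q" "conj_map (fgrp E) g Q = conj_map (fgrp E) q Q"
    using g(2) by (auto simp: finn_def)
  have qc: "q \<in> carrier (fgrp E)" using q Q subgroup.mem_carrier by metis
  let ?z = "inv\<^bsub>fgrp E\<^esub> q \<otimes>\<^bsub>fgrp E\<^esub> g"
  have "?z \<otimes>\<^bsub>fgrp E\<^esub> x = x \<otimes>\<^bsub>fgrp E\<^esub> ?z" if x: "x \<in> Q" for x
  proof -
    have xc: "x \<in> carrier (fgrp E)" using x Q subgroup.mem_carrier by metis
    have "g \<otimes>\<^bsub>fgrp E\<^esub> x \<otimes>\<^bsub>fgrp E\<^esub> inv\<^bsub>fgrp E\<^esub> g = q \<otimes>\<^bsub>fgrp E\<^esub> x \<otimes>\<^bsub>fgrp E\<^esub> inv\<^bsub>fgrp E\<^esub> q"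
      using fun_cong[OF q(2), of x] x by (simp add: conj_map_def)
    then have "g \<otimes>\<^bsub>fgrp E\<^esub> x = q \<otimes>\<^bsub>fgrp E\<^esub> x \<otimes>\<^bsub>fgrp E\<^esub> inv\<^bsub>fgrp E\<^esub> q \<otimes>\<^bsub>fgrp E\<^esub> g"
      using g(1) qc xc by (metis inv_solve_right m_closed inv_closed)
    then have "g \<otimes>\<^bsub>fgrp E\<^esub> x = q \<otimes>\<^bsub>fgrp E\<^esub> (x \<otimes>\<^bsub>fgrp E\<^esub> ?z)"
      using g(1) qc xc by (simp add: m_assoc)
    then have "inv\<^bsub>fgrp E\<^esub> q \<otimes>\<^bsub>fgrp E\<^esub> (g \<otimes>\<^bsub>fgrp E\<^esub> x) = x \<otimes>\<^bsub>fgrp E\<^esub> ?z"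
      using g(1) qc xc by (metis inv_solve_left m_closed inv_closed)
    then show ?thesis using g(1) qc xc by (simp add: m_assoc)
  qed
  then have "?z \<in> centralizer (fgrp E) Q" using g(1) qc by (simp add: centralizer_def)
  then have "?z \<in> Q" using fcentric_centralizer[OF Q] by blast
  then have "q \<otimes>\<^bsub>fgrp E\<^esub> ?z \<in> Q" using q(1) subgroup.m_closed[OF Q(1)] by blast
  then show ?thesis using qc g(1) by (simp flip: m_assoc)
qed

text \<open>The extensions of the automorphisms of \<open>Q\<close> make \<open>Aut\<^sub>M(Q)\<close> a normal \<open>p\<close>-subgroup of \<open>Aut(Q)\<close>, so it is
\<open>Inn(Q)\<close>. A centric \<open>Q\<close> then contains \<open>M\<close>.\<close>

lemma aut_invariant_overgroup_eq:
  assumes Q: "subgroup Q (fgrp E)" "fcentric E Q" and H: "strongly_embedded p H (fout E Q)"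
    and M: "subgroup M (fgrp E)" "Q \<subseteq> M" "M \<subseteq> normalizer (fgrp E) Q"
    and ext: "\<And>\<alpha>. \<alpha> \<in> fhom E Q Q \<Longrightarrow> \<exists>\<psi>\<in>fhom E M M. \<forall>x\<in>Q. \<psi> x = \<alpha> x"
  shows "M = Q"
proof -
  interpret A: group "faut E Q" by (rule group_faut[OF Q(1)])
  let ?N = "(\<lambda>g. conj_map (fgrp E) g Q) ` M"
  have "?N \<lhd> faut E Q"
  proof (rule A.normal_invI)
    show "subgroup ?N (faut E Q)" by (rule conj_map_image_subgroup[OF Q(1) M(1,3)])
    fix \<alpha> \<beta> assume "\<alpha> \<in> carrier (faut E Q)" and "\<beta> \<in> ?N"
    then obtain g where \<alpha>: "\<alpha> \<in> fhom E Q Q" and g: "g \<in> M" "\<beta> = conj_map (fgrp E) g Q"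
      by auto
    obtain \<psi> where \<psi>: "\<psi> \<in> fhom E M M" "\<forall>x\<in>Q. \<psi> x = \<alpha> x"
      using ext[OF \<alpha>] by blast
    have "\<alpha> \<otimes>\<^bsub>faut E Q\<^esub> \<beta> \<otimes>\<^bsub>faut E Q\<^esub> inv\<^bsub>faut E Q\<^esub> \<alpha> = conj_map (fgrp E) (\<psi> g) Q"
      using conj_map_extension[OF \<alpha> \<psi>(1) M(2) _ g(1)] \<psi>(2) g M(3) by blast
    then show "\<alpha> \<otimes>\<^bsub>faut E Q\<^esub> \<beta> \<otimes>\<^bsub>faut E Q\<^esub> inv\<^bsub>faut E Q\<^esub> \<alpha> \<in> ?N"
      using fhom_mem[OF \<psi>(1) g(1)] by blast
  qed
  moreover have "finn E Q \<subseteq> ?N" using M(2) by (auto simp: finn_def)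
  moreover obtain j where "card ?N = p ^ j" using card_conj_map_image[OF Q(1) M(1,3)] .
  ultimately have N: "?N = finn E Q"
    using A.strongly_embedded_quotient_normal_p_subgroup[OF prime_p finite_faut finn_normal[OF Q(1)]] H
    unfolding fout_def by blast
  have "g \<in> Q" if "g \<in> M" for g
    using fcentric_conj_map_finn[OF Q] N that subgroup.mem_carrier[OF M(1)] by blast
  then show ?thesis using M(2) by blast
qed

text \<open>Normalizers grow inside every overgroup \<open>K\<close>, not only inside the whole group: this is what makes
\<open>Q\<close> equal to \<open>K\<close> once \<open>N\<^sub>K(Q) = Q\<close> is known.\<close>

lemma normalizer_proper_overgroup:
  assumes "subgroup P (fgrp E)" "subgroup K (fgrp E)" "P \<subseteq> K" "P \<noteq> K"
  obtains g where "g \<in> K" "g \<in> normalizer (fgrp E) P" "g \<notin> P"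
proof -
  let ?K = "fgrp E\<lparr>carrier := K\<rparr>"
  interpret K: group ?K by (rule subgroup_imp_group[OF assms(2)])
  obtain n where "order ?K = p ^ n"
    using card_subgroup_prime_power[OF assms(2)] by (auto simp: order_def)
  then obtain g where g: "g \<in> normalizer ?K P" "g \<notin> P"
    using K.p_group_normalizer_grows[OF prime_p _ subgroup_incl[OF assms(1-3)]] assms(4) by auto
  have gK: "g \<in> K" using g(1) K.mem_normalizer_iff[of P] assms(3) by simp
  moreover have "(\<lambda>x. g \<otimes>\<^bsub>fgrp E\<^esub> x \<otimes>\<^bsub>fgrp E\<^esub> inv\<^bsub>fgrp E\<^esub> g) ` P = P"
    using g(1) K.mem_normalizer_iff[of P] assms(3) m_inv_consistent[OF assms(2) gK] by simp
  ultimately have "g \<in> normalizer (fgrp E) P"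
    using mem_normalizer[OF assms(1)] subgroup.mem_carrier[OF assms(2)] by blast
  then show ?thesis using that gK g(2) by blast
qed

lemma fully_normalized_representative:
  assumes "subgroup P (fgrp E)"
  obtains R where "fconj E P R" "fully_normalized E R"
proof -
  let ?f = "\<lambda>R. card (normalizer (fgrp E) R)"
  have "?f R < Suc (card (carrier (fgrp E)))" if "fconj E P R" for R
    using card_mono[OF finite_fgrp subgroup.subset[OF subgroup_normalizer]] fconj_subgroup[OF that]
    by (simp add: less_Suc_eq_le)
  then obtain R where R: "fconj E P R" "\<forall>R'. fconj E P R' \<longrightarrow> ?f R' \<le> ?f R"
    using ex_has_greatest_nat[of "fconj E P" P ?f] fconj_refl[OF assms] by blast
  then have "fully_normalized E R"
    using fconj_subgroup[OF R(1)] fconj_trans[OF R(1)] by (auto simp: fully_normalized_def)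
  then show ?thesis using that R(1) by blast
qed

text \<open>For an automorphism \<open>\<alpha>\<close> of \<open>R\<close>, membership in \<open>N\<^sub>\<alpha>\<close> is a statement in the group \<open>Aut(R)\<close>, to which
the criterion for strongly embedded subgroups applies.\<close>

lemma ext_dom_faut:
  assumes "\<alpha> \<in> fhom E R R"
  shows "g \<in> ext_dom E R \<alpha> \<longleftrightarrow> g \<in> normalizer (fgrp E) R \<and>
    \<alpha> \<otimes>\<^bsub>faut E R\<^esub> conj_map (fgrp E) g R \<otimes>\<^bsub>faut E R\<^esub> inv\<^bsub>faut E R\<^esub> \<alpha> \<in> faut_grp E R"
proof (cases "g \<in> normalizer (fgrp E) R")
  case True
  have inv: "inv_into R \<alpha> x = (inv\<^bsub>faut E R\<^esub> \<alpha>) x" if "x \<in> R" for x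
    by (rule inv_into_f_eq[OF fhom_inj[OF assms]])
      (use inv_faut[OF assms] that fhom_mem in auto)
  have "restrict (\<alpha> \<circ> conj_map (fgrp E) g R \<circ> inv_into R \<alpha>) R
      = \<alpha> \<otimes>\<^bsub>faut E R\<^esub> conj_map (fgrp E) g R \<otimes>\<^bsub>faut E R\<^esub> inv\<^bsub>faut E R\<^esub> \<alpha>"
    unfolding conj_faut[OF assms conj_map_mem_faut[OF fhom_subgroup(1)[OF assms] True]]
    by (rule restrict_ext) (simp add: inv)
  then show ?thesis using True by (simp add: ext_dom_def fhom_image_eq[OF assms])
qed (simp add: ext_dom_def)


section \<open>Extension of morphisms in saturated fusion systems\<close>

text \<open>Conjugation on \<open>U\<close>, transported to \<open>R\<close> along the isomorphism \<open>\<phi>\<close>. Its image \<open>\<phi> Aut\<^sub>S(U) \<phi>\<^sup>-\<^sup>1\<close> is a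
\<open>p\<close>-subgroup of \<open>Aut(R)\<close>.\<close>

lemma transport_conj_hom:
  assumes \<phi>: "\<phi> \<in> fhom E U R" and \<psi>: "\<psi> \<in> fhom E R U"
    and inv: "\<And>x. x \<in> U \<Longrightarrow> \<psi> (\<phi> x) = x"
  shows "group_hom (fgrp E\<lparr>carrier := normalizer (fgrp E) U\<rparr>) (faut E R)
           (\<lambda>g. \<lambda>y\<in>R. \<phi> (conj_map (fgrp E) g U (\<psi> y)))"
proof -
  note U = fhom_subgroup(1)[OF \<phi>] and R = fhom_subgroup(2)[OF \<phi>]
  let ?h = "\<lambda>g. \<lambda>y\<in>R. \<phi> (conj_map (fgrp E) g U (\<psi> y))"
  interpret c: group_hom "fgrp E\<lparr>carrier := normalizer (fgrp E) U\<rparr>" "faut E U"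
      "\<lambda>g. conj_map (fgrp E) g U"
    by (rule conj_map_hom[OF U])
  have mem: "?h g \<in> fhom E R R" if g: "g \<in> normalizer (fgrp E) U" for g
  proof -
    have "(\<lambda>y\<in>R. conj_map (fgrp E) g U (\<psi> y)) \<in> fhom E R U"
      by (rule fhom_comp[OF \<psi> conj_map_mem_faut[OF U g]])
    from fhom_comp[OF this \<phi>] show ?thesis by (simp cong: restrict_cong)
  qed
  have mult: "?h (g \<otimes>\<^bsub>fgrp E\<^esub> g') = ?h g \<otimes>\<^bsub>faut E R\<^esub> ?h g'"
    if g: "g \<in> normalizer (fgrp E) U" and g': "g' \<in> normalizer (fgrp E) U" for g g'
    unfolding mult_faut[OF mem[OF g] mem[OF g']]
  proof (rule restrict_ext)
    fix y assume y: "y \<in> R"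
    have u: "\<psi> y \<in> U" by (rule fhom_mem[OF \<psi> y])
    have u': "conj_map (fgrp E) g' U (\<psi> y) \<in> U"
      by (rule fhom_mem[OF conj_map_mem_faut[OF U g'] u])
    have "conj_map (fgrp E) (g \<otimes>\<^bsub>fgrp E\<^esub> g') U (\<psi> y)
        = conj_map (fgrp E) g U (conj_map (fgrp E) g' U (\<psi> y))"
      using c.hom_mult[of g g'] g g' u
      by (simp add: mult_faut[OF conj_map_mem_faut[OF U g] conj_map_mem_faut[OF U g']])
    then show "\<phi> (conj_map (fgrp E) (g \<otimes>\<^bsub>fgrp E\<^esub> g') U (\<psi> y)) = ?h g (?h g' y)"
      using y inv[OF u'] fhom_mem[OF \<phi> u'] by simp
  qed
  show ?thesis
    unfolding group_hom_def group_hom_axioms_def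
    using mem mult c.G.is_group group_faut[OF R] by (auto intro!: homI)
qed

end

context saturated_fusion_system
begin

text \<open>As \<open>Aut\<^sub>S(R)\<close> is a Sylow subgroup of \<open>Aut(R)\<close>, some \<open>\<alpha> \<in> Aut(R)\<close> conjugates \<open>\<phi> Aut\<^sub>S(U) \<phi>\<^sup>-\<^sup>1\<close> into it. Then
\<open>N\<^bsub>\<alpha>\<phi>\<^esub>\<close> is all of \<open>N\<^sub>S(U)\<close>, and the extension axiom applies to \<open>\<alpha>\<phi>\<close>.\<close>

lemma fully_normalized_receives_normalizer:
  assumes R: "fully_normalized E R" and \<phi>: "\<phi> \<in> fhom E U R" "\<phi> ` U = R"
  obtains \<chi> where "\<chi> \<in> fhom E (normalizer (fgrp E) U) (carrier (fgrp E))" "\<chi> ` U = R"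
proof -
  note UG = fhom_subgroup(1)[OF \<phi>(1)] and RG = fhom_subgroup(2)[OF \<phi>(1)]
  obtain \<psi> where \<psi>: "\<psi> \<in> fhom E R U" "\<psi> ` R = U"
    and inv1: "\<And>x. x \<in> U \<Longrightarrow> \<psi> (\<phi> x) = x" and inv2: "\<And>y. y \<in> R \<Longrightarrow> \<phi> (\<psi> y) = y"
    using fhom_inverse[OF \<phi>] by metis
  let ?N = "normalizer (fgrp E) U"
  let ?h = "\<lambda>g. \<lambda>y\<in>R. \<phi> (conj_map (fgrp E) g U (\<psi> y))"
  interpret h: group_hom "fgrp E\<lparr>carrier := ?N\<rparr>" "faut E R" ?h
    by (rule transport_conj_hom[OF \<phi>(1) \<psi>(1) inv1])
  have X: "subgroup (?h ` ?N) (faut E R)"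
    using h.subgroup_img_is_subgroup[OF h.G.subgroup_self] by simp
  obtain k where "card ?N = p ^ k" using card_subgroup_prime_power[OF subgroup_normalizer[OF UG]] .
  then obtain j where cX: "card (?h ` ?N) = p ^ j"
    using h.card_image_dvd_order prime_p by (auto simp: order_def divides_primepow_nat)
  have "sylow_subgroup p (faut_grp E R) (faut E R)" by (rule fully_normalized_sylow[OF R])
  then obtain \<alpha> where \<alpha>: "\<alpha> \<in> fhom E R R"
    and into: "\<And>g. g \<in> ?N \<Longrightarrow> \<alpha> \<otimes>\<^bsub>faut E R\<^esub> ?h g \<otimes>\<^bsub>faut E R\<^esub> inv\<^bsub>faut E R\<^esub> \<alpha> \<in> faut_grp E R"
    using h.H.sylow_conj_into[OF finite_faut prime_p _ _ X cX]
    unfolding sylow_subgroup_def carrier_faut by blast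
  let ?\<chi> = "\<lambda>x\<in>U. \<alpha> (\<phi> x)"
  have im: "?\<chi> ` U = R" using \<phi>(2) fhom_image_eq[OF \<alpha>] by force
  have "?\<chi> \<in> fhom E U R" by (rule fhom_comp[OF \<phi>(1) \<alpha>])
  then have \<chi>: "?\<chi> \<in> fhom E U (carrier (fgrp E))"
    using fhom_codomain[OF _ subgroup_self] im subgroup.subset[OF RG] by blast
  have "ext_dom E U ?\<chi> = ?N"
  proof -
    have "restrict (?\<chi> \<circ> conj_map (fgrp E) g U \<circ> inv_into U ?\<chi>) R \<in> faut_grp E R"
      if g: "g \<in> ?N" for g
    proof -
      have hg: "?h g \<in> fhom E R R" using h.hom_closed[of g] g by simp
      have "restrict (?\<chi> \<circ> conj_map (fgrp E) g U \<circ> inv_into U ?\<chi>) R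
          = \<alpha> \<otimes>\<^bsub>faut E R\<^esub> ?h g \<otimes>\<^bsub>faut E R\<^esub> inv\<^bsub>faut E R\<^esub> \<alpha>"
        unfolding conj_faut[OF \<alpha> hg]
      proof (rule restrict_ext)
        fix y assume y: "y \<in> R"
        let ?z = "(inv\<^bsub>faut E R\<^esub> \<alpha>) y"
        have z: "?z \<in> R" "\<alpha> ?z = y" using inv_faut[OF \<alpha>] y fhom_mem by blast+
        have u: "\<psi> ?z \<in> U" by (rule fhom_mem[OF \<psi>(1) z(1)])
        have "inv_into U ?\<chi> y = \<psi> ?z"
          by (rule inv_into_f_eq[OF fhom_inj[OF \<chi>] u]) (simp add: u inv2[OF z(1)] z(2))
        moreover have "conj_map (fgrp E) g U (\<psi> ?z) \<in> U"
          by (rule fhom_mem[OF conj_map_mem_faut[OF UG g] u])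
        ultimately show "(?\<chi> \<circ> conj_map (fgrp E) g U \<circ> inv_into U ?\<chi>) y = \<alpha> (?h g ?z)"
          using z(1) by simp
      qed
      then show ?thesis using into[OF g] by simp
    qed
    then show ?thesis unfolding ext_dom_def im by blast
  qed
  moreover have "fully_centralized E (?\<chi> ` U)"
    unfolding im by (rule fully_normalized_centralized[OF R])
  ultimately obtain \<theta> where \<theta>: "\<theta> \<in> fhom E ?N (carrier (fgrp E))" "restrict \<theta> U = ?\<chi>"
    using extension[OF \<chi>] by metis
  have "\<theta> ` U = ?\<chi> ` U" using \<theta>(2) by (metis image_restrict_eq)
  then show ?thesis using that \<theta>(1) im by simp
qed

text \<open>Here \<open>N\<^sub>\<alpha>\<close> contains \<open>R\<close> because \<open>\<alpha>\<close> normalises \<open>Inn(R)\<close>, so a single further element makes it a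
strictly larger domain.\<close>

lemma extends_to_larger:
  assumes R: "fully_normalized E R" and \<alpha>: "\<alpha> \<in> fhom E R R"
    and g: "g \<in> ext_dom E R \<alpha>" "g \<notin> R"
  obtains M \<psi> where "card R < card M" "\<psi> \<in> fhom E M (carrier (fgrp E))"
    "R \<subseteq> M" "restrict \<psi> R = \<alpha>"
proof -
  note RG = fhom_subgroup(1)[OF \<alpha>]
  have \<alpha>S: "\<alpha> \<in> fhom E R (carrier (fgrp E))"
    using fhom_codomain[OF \<alpha> subgroup_self] fhom_image_eq[OF \<alpha>] subgroup.subset[OF RG] by simp
  have "fully_centralized E (\<alpha> ` R)"
    unfolding fhom_image_eq[OF \<alpha>] by (rule fully_normalized_centralized[OF R])
  then obtain \<psi> where \<psi>: "\<psi> \<in> fhom E (ext_dom E R \<alpha>) (carrier (fgrp E))" "restrict \<psi> R = \<alpha>"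
    using extension[OF \<alpha>S] by blast
  have sub: "R \<subseteq> ext_dom E R \<alpha>"
  proof
    fix r assume r: "r \<in> R"
    then have "r \<in> normalizer (fgrp E) R" using subset_normalizer[OF RG] by blast
    moreover have "\<alpha> \<otimes>\<^bsub>faut E R\<^esub> conj_map (fgrp E) r R \<otimes>\<^bsub>faut E R\<^esub> inv\<^bsub>faut E R\<^esub> \<alpha> \<in> finn E R"
      using normal.inv_op_closed2[OF finn_normal[OF RG]] \<alpha> r by (simp add: finn_def)
    ultimately show "r \<in> ext_dom E R \<alpha>"
      using ext_dom_faut[OF \<alpha>] finn_subset_faut_grp[OF RG] by blast
  qed
  have "card R < card (ext_dom E R \<alpha>)"
    using sub g finite_subgroup[OF fhom_subgroup(1)[OF \<psi>(1)]] by (intro psubset_card_mono) auto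
  then show ?thesis using that \<psi> sub by blast
qed

text \<open>For a conjugate \<open>Q\<close> of \<open>R\<close>, \<open>|C\<^sub>S(Q)| \<le> |C\<^sub>S(R)| = |Z(R)| = |Z(Q)|\<close>, the inequality because \<open>R\<close> is
fully centralised.\<close>

lemma fully_normalized_fcentricI:
  assumes R: "fully_normalized E R" and C: "centralizer (fgrp E) R \<subseteq> R"
  shows "fcentric E R"
proof -
  have RG: "subgroup R (fgrp E)" using R by (simp add: fully_normalized_def)
  have Z: "group_center (fgrp E\<lparr>carrier := Q\<rparr>) = Q \<inter> centralizer (fgrp E) Q"
    if "subgroup Q (fgrp E)" for Q
    using subgroup.mem_carrier[OF that] by (auto simp: group_center_def centralizer_def)
  have "centralizer (fgrp E) Q = group_center (fgrp E\<lparr>carrier := Q\<rparr>)" if Q: "fconj E R Q" for Q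
  proof -
    have QG: "subgroup Q (fgrp E)" using fconj_subgroup[OF Q] by blast
    obtain \<phi> where \<phi>: "\<phi> \<in> fhom E R Q" "\<phi> ` R = Q" using Q by (auto simp: fconj_iff)
    have "\<phi> ` centralizer (fgrp E) R \<subseteq> Q \<inter> centralizer (fgrp E) Q"
    proof
      fix y assume "y \<in> \<phi> ` centralizer (fgrp E) R"
      then obtain z where z: "z \<in> centralizer (fgrp E) R" "z \<in> R" "y = \<phi> z" using C by blast
      have "\<phi> z \<otimes>\<^bsub>fgrp E\<^esub> \<phi> x = \<phi> x \<otimes>\<^bsub>fgrp E\<^esub> \<phi> z" if "x \<in> R" for x
        using z that fhom_mult[OF \<phi>(1)] by (simp add: centralizer_def flip: fhom_mult[OF \<phi>(1)])
      then show "y \<in> Q \<inter> centralizer (fgrp E) Q"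
        using z(2,3) \<phi> subgroup.mem_carrier[OF QG] by (auto simp: centralizer_def)
    qed
    then have "card (\<phi> ` centralizer (fgrp E) R) \<le> card (Q \<inter> centralizer (fgrp E) Q)"
      using finite_subgroup[OF QG] by (intro card_mono) auto
    moreover have "card (\<phi> ` centralizer (fgrp E) R) = card (centralizer (fgrp E) R)"
      by (rule card_image[OF inj_on_subset[OF fhom_inj[OF \<phi>(1)] C]])
    moreover have "card (centralizer (fgrp E) Q) \<le> card (centralizer (fgrp E) R)"
      using fully_normalized_centralized[OF R] Q by (auto simp: fully_centralized_def)
    moreover have "finite (centralizer (fgrp E) Q)"
      using finite_fgrp by (simp add: centralizer_def)
    ultimately have "Q \<inter> centralizer (fgrp E) Q = centralizer (fgrp E) Q"
      by (intro card_seteq) auto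
    then show ?thesis using Z[OF QG] by simp
  qed
  then show ?thesis using RG by (simp add: fcentric_def)
qed

text \<open>The induction step for the extension theorem. If \<open>R\<close> is not centric, an element of
\<open>C\<^sub>S(R) - R\<close> lies in \<open>N\<^sub>\<alpha>\<close>, so \<open>\<alpha>\<close> extends to a larger group and then to \<open>S\<close>. If \<open>R\<close> is centric, let
\<open>H \<ge> Aut\<^sub>S(R)\<close> consist of the automorphisms that extend to \<open>S\<close>. An element \<open>\<kappa>\<close> that conjugates a
subgroup \<open>Y\<close> of \<open>Aut\<^sub>S(R)\<close> with \<open>|Y| > |Inn(R)|\<close> into \<open>Aut\<^sub>S(R)\<close> has \<open>N\<^sub>\<kappa> > R\<close>, so it is in \<open>H\<close>. Were \<open>H\<close>
proper, its image in \<open>Out(R)\<close> would be strongly \<open>p\<close>-embedded and \<open>R\<close> essential.\<close>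

lemma automorphism_extends_if_not_essential:
  assumes R: "fully_normalized E R" "R \<noteq> carrier (fgrp E)" "R \<notin> fessential p E"
    and IH: "\<And>M \<psi>. card R < card M \<Longrightarrow> \<psi> \<in> fhom E M (carrier (fgrp E)) \<Longrightarrow>
        \<exists>\<beta>\<in>fhom E (carrier (fgrp E)) (carrier (fgrp E)). \<forall>x\<in>M. \<beta> x = \<psi> x"
    and \<alpha>: "\<alpha> \<in> fhom E R R"
  shows "\<exists>\<beta>\<in>fhom E (carrier (fgrp E)) (carrier (fgrp E)). \<forall>x\<in>R. \<beta> x = \<alpha> x"
proof -
  note RG = fhom_subgroup(1)[OF \<alpha>]
  let ?S = "carrier (fgrp E)"
  interpret A: group "faut E R" by (rule group_faut[OF RG])
  have larger: "\<exists>\<beta>\<in>fhom E ?S ?S. \<forall>x\<in>R. \<beta> x = \<gamma> x"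
    if \<gamma>: "\<gamma> \<in> fhom E R R" and g: "g \<in> ext_dom E R \<gamma>" "g \<notin> R" for \<gamma> g
  proof -
    obtain M \<psi> where M: "card R < card M" "\<psi> \<in> fhom E M ?S" "R \<subseteq> M" "restrict \<psi> R = \<gamma>"
      using extends_to_larger[OF R(1) \<gamma> g] .
    obtain \<beta> where \<beta>: "\<beta> \<in> fhom E ?S ?S" "\<forall>x\<in>M. \<beta> x = \<psi> x" using IH[OF M(1,2)] by blast
    have "\<beta> x = \<gamma> x" if "x \<in> R" for x
      using \<beta>(2) M(3) that fun_cong[OF M(4), of x] by auto
    then show ?thesis using \<beta>(1) by blast
  qed
  show ?thesis
  proof (cases "centralizer (fgrp E) R \<subseteq> R")
    case False
    then obtain g where g: "g \<in> centralizer (fgrp E) R" "g \<notin> R" by blast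
    then have gc: "g \<in> ?S" by (simp add: centralizer_def)
    have triv: "g \<otimes>\<^bsub>fgrp E\<^esub> x \<otimes>\<^bsub>fgrp E\<^esub> inv\<^bsub>fgrp E\<^esub> g = x" if "x \<in> R" for x
      using g(1) that subgroup.mem_carrier[OF RG that] gc by (simp add: centralizer_def m_assoc)
    have "conj_map (fgrp E) g R = \<one>\<^bsub>faut E R\<^esub>"
      using triv by (auto simp: conj_map_def one_faut)
    then have "\<alpha> \<otimes>\<^bsub>faut E R\<^esub> conj_map (fgrp E) g R \<otimes>\<^bsub>faut E R\<^esub> inv\<^bsub>faut E R\<^esub> \<alpha> = \<one>\<^bsub>faut E R\<^esub>"
      using \<alpha> by simp
    then have "g \<in> ext_dom E R \<alpha>"
      using ext_dom_faut[OF \<alpha>] triv gc subgroup.one_closed[OF faut_grp_subgroup[OF RG]]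
      by (simp add: mem_normalizer RG)
    then show ?thesis using larger[OF \<alpha> _ g(2)] by blast
  next
    case True
    have cent: "fcentric E R" by (rule fully_normalized_fcentricI[OF R(1) True])
    define H where "H = {\<gamma> \<in> fhom E R R. \<exists>\<beta>\<in>fhom E ?S ?S. \<forall>x\<in>R. \<beta> x = \<gamma> x}"
    have H: "subgroup H (faut E R)"
    proof (rule A.subgroupI)
      have "\<one>\<^bsub>faut E R\<^esub> \<in> H"
        using A.one_closed fhom_incl[OF subgroup_self subgroup_self subset_refl] subgroup.mem_carrier[OF RG]
        by (auto simp: H_def one_faut intro!: bexI[of _ "\<lambda>x\<in>?S. x"])
      then show "H \<noteq> {}" by blast
      show "H \<subseteq> carrier (faut E R)" by (auto simp: H_def)
      fix \<gamma> assume "\<gamma> \<in> H"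
      then obtain \<beta> where \<gamma>: "\<gamma> \<in> fhom E R R" and \<beta>: "\<beta> \<in> fhom E ?S ?S" "\<forall>x\<in>R. \<beta> x = \<gamma> x"
        by (auto simp: H_def)
      obtain \<beta>' where \<beta>': "\<beta>' \<in> fhom E ?S ?S" "\<And>x. x \<in> ?S \<Longrightarrow> \<beta>' (\<beta> x) = x"
        using fhom_inverse[OF \<beta>(1) fhom_image_eq[OF \<beta>(1)]] by metis
      have "\<beta>' x = (inv\<^bsub>faut E R\<^esub> \<gamma>) x" if x: "x \<in> R" for x
      proof -
        have y: "(inv\<^bsub>faut E R\<^esub> \<gamma>) x \<in> R" using inv_faut(1)[OF \<gamma>] x fhom_mem by blast
        then have "\<beta> ((inv\<^bsub>faut E R\<^esub> \<gamma>) x) = x" using \<beta>(2) inv_faut(2)[OF \<gamma> x] by simp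
        then show ?thesis using \<beta>'(2)[OF subgroup.mem_carrier[OF RG y]] by simp
      qed
      then show "inv\<^bsub>faut E R\<^esub> \<gamma> \<in> H" using inv_faut(1)[OF \<gamma>] \<beta>'(1) by (auto simp: H_def)
      fix \<delta> assume "\<delta> \<in> H"
      then obtain \<epsilon> where \<delta>: "\<delta> \<in> fhom E R R" and \<epsilon>: "\<epsilon> \<in> fhom E ?S ?S" "\<forall>x\<in>R. \<epsilon> x = \<delta> x"
        by (auto simp: H_def)
      have "(\<lambda>x\<in>?S. \<beta> (\<epsilon> x)) \<in> fhom E ?S ?S" by (rule fhom_comp[OF \<epsilon>(1) \<beta>(1)])
      moreover have "\<forall>x\<in>R. (\<lambda>x\<in>?S. \<beta> (\<epsilon> x)) x = (\<gamma> \<otimes>\<^bsub>faut E R\<^esub> \<delta>) x"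
        using \<beta>(2) \<epsilon>(2) fhom_mem[OF \<delta>] subgroup.mem_carrier[OF RG] by (simp add: mult_faut[OF \<gamma> \<delta>])
      moreover have "\<gamma> \<otimes>\<^bsub>faut E R\<^esub> \<delta> \<in> fhom E R R" using A.m_closed[of \<gamma> \<delta>] \<gamma> \<delta> by simp
      ultimately show "\<gamma> \<otimes>\<^bsub>faut E R\<^esub> \<delta> \<in> H" unfolding H_def by blast
    qed
    have PH: "faut_grp E R \<subseteq> H"
    proof
      fix \<gamma> assume "\<gamma> \<in> faut_grp E R"
      then obtain g where g: "g \<in> normalizer (fgrp E) R" "\<gamma> = conj_map (fgrp E) g R"
        by (auto simp: faut_grp_def)
      have gc: "g \<in> ?S" using g(1) by (simp add: mem_normalizer RG)
      have "conj_map (fgrp E) g ?S \<in> fhom E ?S ?S"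
        by (rule conj_fhom[OF subgroup_self subgroup_self gc]) (use gc in simp)
      moreover have "\<forall>x\<in>R. conj_map (fgrp E) g ?S x = \<gamma> x"
        using g(2) subgroup.mem_carrier[OF RG] by (simp add: conj_map_def)
      ultimately show "\<gamma> \<in> H" using conj_map_mem_faut[OF RG g(1)] g(2) by (auto simp: H_def)
    qed
    have "H = carrier (faut E R)"
    proof (rule ccontr)
      assume proper: "H \<noteq> carrier (faut E R)"
      obtain i where i: "card (finn E R) = p ^ i" using card_finn[OF RG] .
      have syl: "card (faut_grp E R) = p ^ multiplicity p (order (faut E R))"
        using fully_normalized_sylow[OF R(1)] by (simp add: sylow_subgroup_def)
      have finP: "finite (faut_grp E R)"
        using finite_subset[OF subgroup.subset[OF faut_grp_subgroup[OF RG]] finite_faut] .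
      have less: "card (finn E R) < card (faut_grp E R)"
      proof -
        obtain g where g: "g \<in> ?S" "g \<in> normalizer (fgrp E) R" "g \<notin> R"
          using normalizer_proper_overgroup[OF RG subgroup_self subgroup.subset[OF RG] R(2)] .
        then have "conj_map (fgrp E) g R \<in> faut_grp E R - finn E R"
          using fcentric_conj_map_finn[OF RG cent] by (auto simp: faut_grp_def)
        then show ?thesis
          using finn_subset_faut_grp[OF RG] finP by (intro psubset_card_mono) auto
      qed
      have "strongly_embedded p ((\<lambda>\<gamma>. finn E R #>\<^bsub>faut E R\<^esub> \<gamma>) ` H) (faut E R Mod finn E R)"
      proof (rule A.strongly_embedded_quotientI[OF prime_p finite_faut finn_normal[OF RG] i H _ proper
            faut_grp_subgroup[OF RG] PH syl less])
        show "finn E R \<subseteq> H" using finn_subset_faut_grp[OF RG] PH by blast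
        fix \<kappa> Y assume \<kappa>: "\<kappa> \<in> carrier (faut E R)" and Y: "subgroup Y (faut E R)" "Y \<subseteq> faut_grp E R"
          "card (finn E R) < card Y"
          and into: "\<And>y. y \<in> Y \<Longrightarrow> \<kappa> \<otimes>\<^bsub>faut E R\<^esub> y \<otimes>\<^bsub>faut E R\<^esub> inv\<^bsub>faut E R\<^esub> \<kappa> \<in> faut_grp E R"
        have "\<not> Y \<subseteq> finn E R"
          using Y(3) finite_subset[OF finn_subset_faut_grp[OF RG] finP] card_mono
          by (metis linorder_not_le)
        then obtain y where y: "y \<in> Y" "y \<notin> finn E R" by blast
        then obtain g where g: "g \<in> normalizer (fgrp E) R" "y = conj_map (fgrp E) g R"
          using Y(2) by (auto simp: faut_grp_def)
        have "g \<notin> R" using y(2) g(2) by (auto simp: finn_def)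
        moreover have "\<kappa> \<in> fhom E R R" using \<kappa> by simp
        moreover have "g \<in> ext_dom E R \<kappa>"
          using ext_dom_faut[OF \<open>\<kappa> \<in> fhom E R R\<close>] g into[OF y(1)] by simp
        ultimately show "\<kappa> \<in> H" using larger by (simp add: H_def)
      qed
      then have "R \<in> fessential p E"
        using RG R(1) cent by (auto simp: fessential_def fout_def)
      then show False using R(3) by contradiction
    qed
    then show ?thesis using \<alpha> by (auto simp: H_def)
  qed
qed

text \<open>Larger domains are handled by induction. Let \<open>R\<close> be a fully normalised conjugate of \<open>P < S\<close>. For both
\<open>P\<close> and \<open>\<phi>(P)\<close> there is a morphism onto \<open>R\<close> that is defined on the normalizer, a larger group, and
so it is the restriction of an automorphism of \<open>S\<close>. Modulo these two automorphisms \<open>\<phi>\<close> becomes an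
automorphism of \<open>R\<close>, and the previous lemma applies.\<close>

theorem extends_to_fgrp_if_no_large_essential:
  assumes ess: "\<And>Q. Q \<in> fessential p E \<Longrightarrow> card Q < n"
    and \<phi>: "\<phi> \<in> fhom E P V" "n \<le> card P"
  shows "\<exists>\<beta>\<in>fhom E (carrier (fgrp E)) (carrier (fgrp E)). \<forall>x\<in>P. \<beta> x = \<phi> x"
  using \<phi>
proof (induction "card (carrier (fgrp E)) - card P" arbitrary: P V \<phi> rule: less_induct)
  case less
  let ?S = "carrier (fgrp E)"
  note PG = fhom_subgroup(1)[OF less.prems(1)] and VG = fhom_subgroup(2)[OF less.prems(1)]
  have cP: "card P \<le> card ?S" using card_mono[OF finite_fgrp subgroup.subset[OF PG]] .
  show ?case
  proof (cases "P = ?S")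
    case True
    then have "\<phi> \<in> fhom E ?S ?S"
      using fhom_codomain[OF less.prems(1) subgroup_self] subgroup.subset[OF VG]
        fhom_mem[OF less.prems(1)] by blast
    then show ?thesis by blast
  next
    case False
    then have cPS: "card P < card ?S"
      using cP card_subset_eq[OF finite_fgrp subgroup.subset[OF PG]] by linarith
    have IH: "\<exists>\<beta>\<in>fhom E ?S ?S. \<forall>x\<in>M. \<beta> x = \<psi> x" if "card P < card M" "\<psi> \<in> fhom E M ?S" for M \<psi>
    proof (rule less.hyps[OF _ that(2)])
      show "card ?S - card M < card ?S - card P" using that(1) cPS by linarith
      show "n \<le> card M" using that(1) less.prems(2) by linarith
    qed
    obtain R where R: "fconj E P R" "fully_normalized E R"
      using fully_normalized_representative[OF PG] .
    have cR: "card R = card P" using fconj_card[OF R(1)] by simp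
    have RG: "subgroup R (fgrp E)" using fconj_subgroup[OF R(1)] by blast
    have to_R: "\<exists>\<beta>\<in>fhom E ?S ?S. \<beta> ` U = R" if U: "fconj E U R" for U
    proof -
      have UG: "subgroup U (fgrp E)" and cU: "card U = card P"
        using fconj_subgroup[OF U] fconj_card[OF U] cR by auto
      obtain \<psi> where "\<psi> \<in> fhom E U R" "\<psi> ` U = R" using U by (auto simp: fconj_iff)
      then obtain \<chi> where \<chi>: "\<chi> \<in> fhom E (normalizer (fgrp E) U) ?S" "\<chi> ` U = R"
        using fully_normalized_receives_normalizer[OF R(2)] by blast
      have "U \<noteq> ?S" using cU cPS by auto
      then obtain g where "g \<in> normalizer (fgrp E) U" "g \<notin> U"
        using normalizer_proper_overgroup[OF UG subgroup_self subgroup.subset[OF UG]] by blast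
      then have "card U < card (normalizer (fgrp E) U)"
        using subset_normalizer[OF UG] finite_subgroup[OF subgroup_normalizer[OF UG]]
        by (intro psubset_card_mono) auto
      then obtain \<beta> where \<beta>: "\<beta> \<in> fhom E ?S ?S" "\<forall>x\<in>normalizer (fgrp E) U. \<beta> x = \<chi> x"
        using IH[OF _ \<chi>(1)] cU by auto
      have "\<beta> ` U = \<chi> ` U" using \<beta>(2) subset_normalizer[OF UG] by (intro image_cong) auto
      then show ?thesis using \<beta>(1) \<chi>(2) by auto
    qed
    let ?P' = "\<phi> ` P"
    have \<phi>': "\<phi> \<in> fhom E P ?P'"
      by (rule fhom_codomain[OF less.prems(1) fhom_image_subgroup[OF less.prems(1)] subset_refl])
    then have "fconj E P ?P'" by (auto simp: fconj_iff)
    then have "fconj E ?P' R" using fconj_trans[OF fconj_sym R(1)] by blast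
    then obtain \<beta> \<beta>1 where \<beta>: "\<beta> \<in> fhom E ?S ?S" "\<beta> ` P = R" and \<beta>1: "\<beta>1 \<in> fhom E ?S ?S" "\<beta>1 ` ?P' = R"
      using to_R[OF R(1)] to_R by blast
    obtain \<beta>' where \<beta>': "\<beta>' \<in> fhom E ?S ?S" "\<And>x. x \<in> ?S \<Longrightarrow> \<beta>' (\<beta> x) = x"
      using fhom_inverse[OF \<beta>(1) fhom_image_eq[OF \<beta>(1)]] by metis
    obtain \<beta>1' where \<beta>1': "\<beta>1' \<in> fhom E ?S ?S" "\<And>x. x \<in> ?S \<Longrightarrow> \<beta>1' (\<beta>1 x) = x"
      using fhom_inverse[OF \<beta>1(1) fhom_image_eq[OF \<beta>1(1)]] by metis
    have Pc: "x \<in> ?S" if "x \<in> P" for x using subgroup.mem_carrier[OF PG that] .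
    have P'c: "\<phi> x \<in> ?S" if "x \<in> P" for x
      using subgroup.mem_carrier[OF VG] fhom_mem[OF less.prems(1) that] by blast
    have b'R: "\<beta>' ` R \<subseteq> P" using \<beta>(2) \<beta>'(2) Pc by auto
    have "restrict \<beta>' R \<in> fhom E R P"
      by (rule fhom_restrict[OF \<beta>'(1) RG subgroup.subset[OF RG] PG b'R])
    moreover have "restrict \<beta>1 ?P' \<in> fhom E ?P' R"
      using fhom_restrict[OF \<beta>1(1) fhom_subgroup(2)[OF \<phi>'] _ RG] \<beta>1(2) P'c by blast
    \<comment> \<open>\<open>\<phi>\<close> becomes an automorphism of \<open>R\<close> when source and target are moved to \<open>R\<close> by \<open>\<beta>\<close> and \<open>\<beta>1\<close>.\<close>
    ultimately have "(\<lambda>y\<in>R. restrict \<beta>1 ?P' ((\<lambda>y\<in>R. \<phi> (restrict \<beta>' R y)) y)) \<in> fhom E R R"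
      using fhom_comp[OF fhom_comp[OF _ \<phi>']] by blast
    moreover have "(\<lambda>y\<in>R. restrict \<beta>1 ?P' ((\<lambda>y\<in>R. \<phi> (restrict \<beta>' R y)) y)) = (\<lambda>y\<in>R. \<beta>1 (\<phi> (\<beta>' y)))"
      using b'R by (intro restrict_ext) auto
    ultimately have \<alpha>: "(\<lambda>y\<in>R. \<beta>1 (\<phi> (\<beta>' y))) \<in> fhom E R R" by simp
    have "R \<noteq> ?S" using cR cPS by auto
    moreover have "R \<notin> fessential p E" using ess[of R] cR less.prems(2) by auto
    ultimately obtain \<gamma> where \<gamma>: "\<gamma> \<in> fhom E ?S ?S" "\<forall>y\<in>R. \<gamma> y = (\<lambda>y\<in>R. \<beta>1 (\<phi> (\<beta>' y))) y"
      using automorphism_extends_if_not_essential[OF R(2) _ _ _ \<alpha>] IH cR by auto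
    have "(\<lambda>x\<in>?S. \<beta>1' ((\<lambda>x\<in>?S. \<gamma> (\<beta> x)) x)) \<in> fhom E ?S ?S"
      by (rule fhom_comp[OF fhom_comp[OF \<beta>(1) \<gamma>(1)] \<beta>1'(1)])
    moreover have "\<beta>1' (\<gamma> (\<beta> x)) = \<phi> x" if x: "x \<in> P" for x
    proof -
      have "\<gamma> (\<beta> x) = \<beta>1 (\<phi> x)" using \<gamma>(2) \<beta>(2) \<beta>'(2)[OF Pc[OF x]] x by auto
      then show ?thesis using \<beta>1'(2)[OF P'c[OF x]] by simp
    qed
    ultimately show ?thesis using Pc by (intro bexI) auto
  qed
qed

end

context fusion_system
begin

section \<open>Normalizer fusion systems\<close>

lemma fgrp_fnormalizer: "fgrp (fnormalizer E Q) = fgrp E\<lparr>carrier := normalizer (fgrp E) Q\<rparr>"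
  by (simp add: fnormalizer_def Let_def)

lemma subgroup_fnormalizer_iff:
  assumes "subgroup Q (fgrp E)"
  shows "subgroup U (fgrp (fnormalizer E Q)) \<longleftrightarrow> subgroup U (fgrp E) \<and> U \<subseteq> normalizer (fgrp E) Q"
  unfolding fgrp_fnormalizer
  using incl_subgroup[OF subgroup_normalizer[OF assms]] subgroup.subset[of U "fgrp E\<lparr>carrier := normalizer (fgrp E) Q\<rparr>"]
    subgroup_incl[OF _ subgroup_normalizer[OF assms]] by auto

lemma mem_fhom_fnormalizer:
  assumes "subgroup Q (fgrp E)"
  shows "\<phi> \<in> fhom (fnormalizer E Q) U V \<longleftrightarrow> \<phi> \<in> fhom E U V \<and>
    U \<subseteq> normalizer (fgrp E) Q \<and> V \<subseteq> normalizer (fgrp E) Q \<and>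
    (\<exists>\<psi>\<in>fhom E (U <#>\<^bsub>fgrp E\<^esub> Q) (V <#>\<^bsub>fgrp E\<^esub> Q). restrict \<psi> U = \<phi> \<and> \<psi> ` Q = Q)"
proof -
  have "\<phi> \<in> fhom (fnormalizer E Q) U V \<longleftrightarrow> \<phi> \<in> fhom E U V \<and>
      subgroup U (fgrp (fnormalizer E Q)) \<and> subgroup V (fgrp (fnormalizer E Q)) \<and>
      (\<exists>\<psi>\<in>fhom E (U <#>\<^bsub>fgrp E\<^esub> Q) (V <#>\<^bsub>fgrp E\<^esub> Q). restrict \<psi> U = \<phi> \<and> \<psi> ` Q = Q)"
    by (simp add: fnormalizer_def Let_def)
  then show ?thesis
    unfolding subgroup_fnormalizer_iff[OF assms] using fhom_subgroup[of \<phi> U V] by blast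
qed

lemma fhom_fnormalizerD:
  assumes "subgroup Q (fgrp E)" "\<phi> \<in> fhom (fnormalizer E Q) U V"
  shows "\<phi> \<in> fhom E U V" "U \<subseteq> normalizer (fgrp E) Q" "V \<subseteq> normalizer (fgrp E) Q"
  using mem_fhom_fnormalizer[OF assms(1), of \<phi> U V] assms(2) by simp_all

lemma fhom_fnormalizer_extend:
  assumes "subgroup Q (fgrp E)" "\<phi> \<in> fhom (fnormalizer E Q) U V"
  obtains \<psi> where "\<psi> \<in> fhom E (U <#>\<^bsub>fgrp E\<^esub> Q) (V <#>\<^bsub>fgrp E\<^esub> Q)"
    "restrict \<psi> U = \<phi>" "\<psi> ` Q = Q"
  using mem_fhom_fnormalizer[OF assms(1), of \<phi> U V] assms(2) by auto

lemma fhom_fnormalizerI: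
  assumes "subgroup Q (fgrp E)" "\<phi> \<in> fhom E U V"
    and "U \<subseteq> normalizer (fgrp E) Q" "V \<subseteq> normalizer (fgrp E) Q"
    and "\<psi> \<in> fhom E (U <#>\<^bsub>fgrp E\<^esub> Q) (V <#>\<^bsub>fgrp E\<^esub> Q)" "restrict \<psi> U = \<phi>" "\<psi> ` Q = Q"
  shows "\<phi> \<in> fhom (fnormalizer E Q) U V"
  unfolding mem_fhom_fnormalizer[OF assms(1)] using assms(2-) by blast

lemma subset_set_mult:
  assumes "subgroup U (fgrp E)" "subgroup Q (fgrp E)"
  shows "U \<subseteq> U <#>\<^bsub>fgrp E\<^esub> Q" "Q \<subseteq> U <#>\<^bsub>fgrp E\<^esub> Q"
proof -
  have "u \<otimes>\<^bsub>fgrp E\<^esub> \<one>\<^bsub>fgrp E\<^esub> \<in> U <#>\<^bsub>fgrp E\<^esub> Q" if "u \<in> U" for u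
    using that subgroup.one_closed[OF assms(2)] unfolding set_mult_def by blast
  then show "U \<subseteq> U <#>\<^bsub>fgrp E\<^esub> Q" using subgroup.mem_carrier[OF assms(1)] by fastforce
  have "\<one>\<^bsub>fgrp E\<^esub> \<otimes>\<^bsub>fgrp E\<^esub> q \<in> U <#>\<^bsub>fgrp E\<^esub> Q" if "q \<in> Q" for q
    using that subgroup.one_closed[OF assms(1)] unfolding set_mult_def by blast
  then show "Q \<subseteq> U <#>\<^bsub>fgrp E\<^esub> Q" using subgroup.mem_carrier[OF assms(2)] by fastforce
qed

lemma subgroup_set_mult:
  assumes "subgroup U (fgrp E)" "subgroup Q (fgrp E)" "U \<subseteq> normalizer (fgrp E) Q"
  shows "subgroup (U <#>\<^bsub>fgrp E\<^esub> Q) (fgrp E)"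
proof -
  let ?N = "normalizer (fgrp E) Q"
  note N = subgroup_normalizer[OF assms(2)]
  have Q: "Q \<lhd> fgrp E\<lparr>carrier := ?N\<rparr>"
    by (rule subgroup_in_normalizer[OF assms(2)])
  have U: "subgroup U (fgrp E\<lparr>carrier := ?N\<rparr>)" by (rule subgroup_incl[OF assms(1) N assms(3)])
  have "subgroup (Q <#>\<^bsub>fgrp E\<^esub> U) (fgrp E\<lparr>carrier := ?N\<rparr>)"
    by (rule mult_norm_sub_in_sub[OF Q U N])
  then show ?thesis
    using incl_subgroup[OF N] commut_normal_subgroup[OF N Q U] by simp
qed

lemma set_mult_absorb:
  assumes "subgroup M (fgrp E)" "subgroup Q (fgrp E)" "Q \<subseteq> M"
  shows "M <#>\<^bsub>fgrp E\<^esub> Q = M"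
  by (rule set_mult_subgroup_idem[OF assms(1) subgroup_incl[OF assms(2,1,3)]])

lemma fhom_set_mult_image:
  assumes "\<psi> \<in> fhom E M W" "U \<subseteq> M" "Q \<subseteq> M"
  shows "\<psi> ` (U <#>\<^bsub>fgrp E\<^esub> Q) = \<psi> ` U <#>\<^bsub>fgrp E\<^esub> \<psi> ` Q"
proof -
  have hom: "\<psi> (u \<otimes>\<^bsub>fgrp E\<^esub> q) = \<psi> u \<otimes>\<^bsub>fgrp E\<^esub> \<psi> q" if "u \<in> U" "q \<in> Q" for u q
    using fhom_mult[OF assms(1)] assms(2,3) that by blast
  have "\<psi> ` (U <#>\<^bsub>fgrp E\<^esub> Q) = (\<Union>u\<in>U. \<Union>q\<in>Q. {\<psi> (u \<otimes>\<^bsub>fgrp E\<^esub> q)})"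
    unfolding set_mult_def by blast
  also have "\<dots> = (\<Union>u\<in>U. \<Union>q\<in>Q. {\<psi> u \<otimes>\<^bsub>fgrp E\<^esub> \<psi> q})"
    using hom by simp
  also have "\<dots> = \<psi> ` U <#>\<^bsub>fgrp E\<^esub> \<psi> ` Q"
    unfolding set_mult_def by blast
  finally show ?thesis .
qed

text \<open>This is what gives \<open>O\<^sub>p(N(Q))\<close> a meaning: every fusion system has a greatest normal subgroup
(\<open>fcore_greatest\<close>).\<close>

lemma fusion_system_fnormalizer:
  assumes Q: "subgroup Q (fgrp E)"
  shows "fusion_system p (fnormalizer E Q)"
proof -
  let ?N = "normalizer (fgrp E) Q"
  let ?F = "fnormalizer E Q"
  note N = subgroup_normalizer[OF Q]
  note sub = subgroup_fnormalizer_iff[OF Q]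
  show ?thesis
  proof (rule fusion_system.intro)
    show "prime p" by (rule prime_p)
    show "group (fgrp ?F)" unfolding fgrp_fnormalizer by (rule subgroup_imp_group[OF N])
    show "\<exists>k. order (fgrp ?F) = p ^ k"
      using card_subgroup_prime_power[OF N] by (auto simp: fgrp_fnormalizer order_def)
  next
    fix \<phi> U V assume \<phi>: "\<phi> \<in> fhom ?F U V"
    note \<phi>E = fhom_fnormalizerD(1)[OF Q \<phi>]
      and UN = fhom_fnormalizerD(2)[OF Q \<phi>] and VN = fhom_fnormalizerD(3)[OF Q \<phi>]
    note UG = fhom_subgroup(1)[OF \<phi>E] and VG = fhom_subgroup(2)[OF \<phi>E]
    show "subgroup U (fgrp ?F) \<and> subgroup V (fgrp ?F)" unfolding sub using UG VG UN VN by blast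
    show "\<phi> \<in> extensional U \<and> inj_on \<phi> U \<and> \<phi> \<in> hom (fgrp ?F\<lparr>carrier := U\<rparr>) (fgrp ?F\<lparr>carrier := V\<rparr>)"
      using fhom_inj_hom[OF \<phi>E] by (simp add: fgrp_fnormalizer)
    obtain \<psi> where \<psi>: "\<psi> \<in> fhom E (U <#>\<^bsub>fgrp E\<^esub> Q) (V <#>\<^bsub>fgrp E\<^esub> Q)" "restrict \<psi> U = \<phi>" "\<psi> ` Q = Q"
      by (rule fhom_fnormalizer_extend[OF Q \<phi>])
    have \<psi>U: "\<psi> x = \<phi> x" if "x \<in> U" for x using fun_cong[OF \<psi>(2), of x] that by simp
    have UQ: "U \<subseteq> U <#>\<^bsub>fgrp E\<^esub> Q" "Q \<subseteq> U <#>\<^bsub>fgrp E\<^esub> Q" using subset_set_mult[OF UG Q] .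
    show "compose U \<chi> \<phi> \<in> fhom ?F U W" if \<chi>: "\<chi> \<in> fhom ?F V W" for \<chi> W
    proof -
      note \<chi>E = fhom_fnormalizerD(1)[OF Q \<chi>] and WN = fhom_fnormalizerD(3)[OF Q \<chi>]
      obtain \<theta> where \<theta>: "\<theta> \<in> fhom E (V <#>\<^bsub>fgrp E\<^esub> Q) (W <#>\<^bsub>fgrp E\<^esub> Q)" "restrict \<theta> V = \<chi>" "\<theta> ` Q = Q"
        by (rule fhom_fnormalizer_extend[OF Q \<chi>])
      have \<theta>V: "\<theta> x = \<chi> x" if "x \<in> V" for x using fun_cong[OF \<theta>(2), of x] that by simp
      let ?c = "compose (U <#>\<^bsub>fgrp E\<^esub> Q) \<theta> \<psi>"
      have "?c \<in> fhom E (U <#>\<^bsub>fgrp E\<^esub> Q) (W <#>\<^bsub>fgrp E\<^esub> Q)" by (rule fhom_compose[OF \<psi>(1) \<theta>(1)])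
      moreover have "restrict ?c U = compose U \<chi> \<phi>"
        using UQ(1) \<psi>U \<theta>V fhom_mem[OF \<phi>E] by (auto simp: compose_def fun_eq_iff)
      moreover have "?c ` Q = Q"
      proof -
        have "?c ` Q = (\<lambda>x. \<theta> (\<psi> x)) ` Q"
          using UQ(2) by (intro image_cong) (auto simp: compose_def)
        also have "\<dots> = \<theta> ` \<psi> ` Q" by (simp add: image_image)
        finally show ?thesis using \<psi>(3) \<theta>(3) by simp
      qed
      ultimately show ?thesis by (rule fhom_fnormalizerI[OF Q fhom_compose[OF \<phi>E \<chi>E] UN WN])
    qed
    show "\<phi> \<in> fiso ?F U (\<phi> ` U)"
    proof -
      let ?V = "\<phi> ` U"
      have V'N: "?V \<subseteq> ?N" using fhom_mem[OF \<phi>E] VN by blast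
      have V'G: "subgroup ?V (fgrp E)" by (rule fhom_image_subgroup[OF \<phi>E])
      have \<phi>': "\<phi> \<in> fhom E U ?V" by (rule fhom_codomain[OF \<phi>E V'G subset_refl])
      have im: "\<psi> ` (U <#>\<^bsub>fgrp E\<^esub> Q) = ?V <#>\<^bsub>fgrp E\<^esub> Q"
        using fhom_set_mult_image[OF \<psi>(1) UQ] \<psi>(3) \<psi>U by simp
      have V'Q: "subgroup (?V <#>\<^bsub>fgrp E\<^esub> Q) (fgrp E)" by (rule subgroup_set_mult[OF V'G Q V'N])
      have \<psi>': "\<psi> \<in> fhom E (U <#>\<^bsub>fgrp E\<^esub> Q) (?V <#>\<^bsub>fgrp E\<^esub> Q)"
        by (rule fhom_codomain[OF \<psi>(1) V'Q]) (simp add: im)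
      have \<phi>F: "\<phi> \<in> fhom ?F U ?V" by (rule fhom_fnormalizerI[OF Q \<phi>' UN V'N \<psi>' \<psi>(2,3)])
      obtain \<theta> where \<theta>: "\<theta> \<in> fhom E (?V <#>\<^bsub>fgrp E\<^esub> Q) (U <#>\<^bsub>fgrp E\<^esub> Q)"
        and inv: "\<And>x. x \<in> U <#>\<^bsub>fgrp E\<^esub> Q \<Longrightarrow> \<theta> (\<psi> x) = x"
        using fhom_inverse[OF \<psi>' im] by metis
      have V'Qs: "?V \<subseteq> ?V <#>\<^bsub>fgrp E\<^esub> Q" using subset_set_mult(1)[OF V'G Q] .
      have \<theta>\<phi>: "\<theta> (\<phi> x) = x" if "x \<in> U" for x
        using inv[of x] \<psi>U[OF that] that UQ(1) by auto
      have "restrict \<theta> ?V \<in> fhom E ?V U"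
        by (rule fhom_restrict[OF \<theta> V'G V'Qs UG]) (use \<theta>\<phi> in auto)
      from fhom_fnormalizerI[OF Q this V'N UN \<theta> refl]
      have \<theta>F: "restrict \<theta> ?V \<in> fhom ?F ?V U" if "\<theta> ` Q = Q" using that .
      have \<theta>Q: "\<theta> ` Q = Q"
      proof -
        have "\<theta> ` \<psi> ` Q = Q" using inv UQ(2) by (force simp: image_image)
        then show ?thesis using \<psi>(3) by simp
      qed
      have "compose U (restrict \<theta> ?V) \<phi> = (\<lambda>x\<in>U. x)"
        using \<theta>\<phi> by (auto simp: compose_def)
      moreover have "compose ?V \<phi> (restrict \<theta> ?V) = (\<lambda>y\<in>?V. y)"
        unfolding compose_def by (rule restrict_ext) (use \<theta>\<phi> in auto)
      ultimately show ?thesis using \<phi>F \<theta>F[OF \<theta>Q] unfolding fiso_def by blast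
    qed
  next
    fix U V g
    assume U: "subgroup U (fgrp ?F)" and V: "subgroup V (fgrp ?F)" and "g \<in> carrier (fgrp ?F)"
      and im: "conj_map (fgrp ?F) g U ` U \<subseteq> V"
    then have UG: "subgroup U (fgrp E)" "U \<subseteq> ?N" and VG: "subgroup V (fgrp E)" "V \<subseteq> ?N"
      and g: "g \<in> ?N" unfolding sub by (simp_all add: fgrp_fnormalizer)
    have gc: "g \<in> carrier (fgrp E)" and gQ: "\<And>x. x \<in> Q \<Longrightarrow> g \<otimes>\<^bsub>fgrp E\<^esub> x \<otimes>\<^bsub>fgrp E\<^esub> inv\<^bsub>fgrp E\<^esub> g \<in> Q"
      using g mem_normalizer[OF Q] by auto
    have c: "conj_map (fgrp ?F) g W = conj_map (fgrp E) g W" for W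
      using m_inv_consistent[OF N g] by (simp add: conj_map_def fgrp_fnormalizer)
    have gU: "g \<otimes>\<^bsub>fgrp E\<^esub> x \<otimes>\<^bsub>fgrp E\<^esub> inv\<^bsub>fgrp E\<^esub> g \<in> V" if "x \<in> U" for x
      using im that unfolding c by (auto simp: conj_map_def)
    note UQG = subgroup_set_mult[OF UG(1) Q UG(2)] and VQG = subgroup_set_mult[OF VG(1) Q VG(2)]
    have "g \<otimes>\<^bsub>fgrp E\<^esub> y \<otimes>\<^bsub>fgrp E\<^esub> inv\<^bsub>fgrp E\<^esub> g \<in> V <#>\<^bsub>fgrp E\<^esub> Q"
      if y: "y \<in> U <#>\<^bsub>fgrp E\<^esub> Q" for y
    proof -
      obtain u q where uq: "u \<in> U" "q \<in> Q" "y = u \<otimes>\<^bsub>fgrp E\<^esub> q"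
        using y by (auto simp: set_mult_def)
      have uqc: "u \<in> carrier (fgrp E)" "q \<in> carrier (fgrp E)"
        using uq subgroup.mem_carrier[OF UG(1)] subgroup.mem_carrier[OF Q] by auto
      have "g \<otimes>\<^bsub>fgrp E\<^esub> y \<otimes>\<^bsub>fgrp E\<^esub> inv\<^bsub>fgrp E\<^esub> g
          = (g \<otimes>\<^bsub>fgrp E\<^esub> u \<otimes>\<^bsub>fgrp E\<^esub> inv\<^bsub>fgrp E\<^esub> g)
              \<otimes>\<^bsub>fgrp E\<^esub> (g \<otimes>\<^bsub>fgrp E\<^esub> q \<otimes>\<^bsub>fgrp E\<^esub> inv\<^bsub>fgrp E\<^esub> g)"
        unfolding uq(3) by (rule conj_mult_distrib[OF gc uqc])
      then show ?thesis using gU[OF uq(1)] gQ[OF uq(2)] by (auto simp: set_mult_def)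
    qed
    then have "conj_map (fgrp E) g (U <#>\<^bsub>fgrp E\<^esub> Q) \<in> fhom E (U <#>\<^bsub>fgrp E\<^esub> Q) (V <#>\<^bsub>fgrp E\<^esub> Q)"
      by (rule conj_fhom[OF UQG VQG gc])
    moreover have "restrict (conj_map (fgrp E) g (U <#>\<^bsub>fgrp E\<^esub> Q)) U = conj_map (fgrp E) g U"
      using subset_set_mult(1)[OF UG(1) Q] by (auto simp: conj_map_def fun_eq_iff)
    moreover have "conj_map (fgrp E) g (U <#>\<^bsub>fgrp E\<^esub> Q) ` Q = Q"
    proof -
      have "conj_map (fgrp E) g (U <#>\<^bsub>fgrp E\<^esub> Q) ` Q
          = (\<lambda>x. g \<otimes>\<^bsub>fgrp E\<^esub> x \<otimes>\<^bsub>fgrp E\<^esub> inv\<^bsub>fgrp E\<^esub> g) ` Q"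
        using subset_set_mult(2)[OF UG(1) Q] by (intro image_cong) (auto simp: conj_map_def)
      then show ?thesis using g mem_normalizer_iff[OF subgroup.subset[OF Q]] by simp
    qed
    moreover have "conj_map (fgrp E) g U \<in> fhom E U V"
      by (rule conj_fhom[OF UG(1) VG(1) gc gU])
    ultimately show "conj_map (fgrp ?F) g U \<in> fhom ?F U V"
      unfolding c by (intro fhom_fnormalizerI[OF Q _ UG(2) VG(2)])
  qed
qed

section \<open>Normal subgroups and the core\<close>

lemma fnormal_iff:
  "fnormal E Q \<longleftrightarrow> subgroup Q (fgrp E) \<and> normalizer (fgrp E) Q = carrier (fgrp E) \<and>
     (\<forall>U V. \<forall>\<phi>\<in>fhom E U V. \<exists>\<psi>\<in>fhom E (U <#>\<^bsub>fgrp E\<^esub> Q) (V <#>\<^bsub>fgrp E\<^esub> Q).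
        restrict \<psi> U = \<phi> \<and> \<psi> ` Q = Q)"
  (is "_ \<longleftrightarrow> _ \<and> ?norm \<and> ?ext")
proof (cases "subgroup Q (fgrp E)")
  case True
  have "fnormalizer E Q = E \<longleftrightarrow> ?norm \<and> ?ext"
  proof
    assume eq: "fnormalizer E Q = E"
    have "carrier (fgrp E) = carrier (fgrp (fnormalizer E Q))" using eq by simp
    then have ?norm by (simp add: fgrp_fnormalizer)
    moreover have ?ext
      using fhom_fnormalizer_extend[OF True] unfolding eq by metis
    ultimately show "?norm \<and> ?ext" by blast
  next
    assume *: "?norm \<and> ?ext"
    have "\<phi> \<in> fhom (fnormalizer E Q) U V \<longleftrightarrow> \<phi> \<in> fhom E U V" for \<phi> U V
    proof
      assume \<phi>: "\<phi> \<in> fhom E U V"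
      then obtain \<psi> where \<psi>: "\<psi> \<in> fhom E (U <#>\<^bsub>fgrp E\<^esub> Q) (V <#>\<^bsub>fgrp E\<^esub> Q)"
        "restrict \<psi> U = \<phi>" "\<psi> ` Q = Q" using * by blast
      show "\<phi> \<in> fhom (fnormalizer E Q) U V"
        by (rule fhom_fnormalizerI[OF True \<phi> _ _ \<psi>])
          (use * fhom_subgroup[OF \<phi>] in \<open>simp_all add: subgroup.subset\<close>)
    qed (rule fhom_fnormalizerD(1)[OF True])
    then have "fhom (fnormalizer E Q) = fhom E" by blast
    moreover have "fgrp (fnormalizer E Q) = fgrp E" using * by (simp add: fgrp_fnormalizer)
    ultimately show "fnormalizer E Q = E" by simp
  qed
  then show ?thesis using True by (simp add: fnormal_def)
qed (simp add: fnormal_def)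

lemma fnormal_subgroup: "fnormal E Q \<Longrightarrow> subgroup Q (fgrp E)"
  by (simp add: fnormal_def)

lemma fnormal_extend:
  assumes "fnormal E Q" "\<phi> \<in> fhom E U V"
  obtains \<psi> where "\<psi> \<in> fhom E (U <#>\<^bsub>fgrp E\<^esub> Q) (V <#>\<^bsub>fgrp E\<^esub> Q)"
    "\<And>x. x \<in> U \<Longrightarrow> \<psi> x = \<phi> x" "\<psi> ` Q = Q"
proof -
  obtain \<psi> where \<psi>: "\<psi> \<in> fhom E (U <#>\<^bsub>fgrp E\<^esub> Q) (V <#>\<^bsub>fgrp E\<^esub> Q)" "restrict \<psi> U = \<phi>" "\<psi> ` Q = Q"
    using assms fnormal_iff by blast
  have "\<psi> x = \<phi> x" if "x \<in> U" for x using fun_cong[OF \<psi>(2), of x] that by simp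
  then show ?thesis using that \<psi>(1,3) by blast
qed

lemma fnormal_trivial: "fnormal E {\<one>\<^bsub>fgrp E\<^esub>}"
  unfolding fnormal_iff
proof (intro conjI allI ballI)
  show triv: "subgroup {\<one>\<^bsub>fgrp E\<^esub>} (fgrp E)" by (rule triv_subgroup)
  show "normalizer (fgrp E) {\<one>\<^bsub>fgrp E\<^esub>} = carrier (fgrp E)"
    by (rule Set.set_eqI) (simp add: mem_normalizer[OF triv] cong: conj_cong)
  fix U V \<phi> assume \<phi>: "\<phi> \<in> fhom E U V"
  have 1: "U <#>\<^bsub>fgrp E\<^esub> {\<one>\<^bsub>fgrp E\<^esub>} = U" if "subgroup U (fgrp E)" for U
    using set_mult_absorb[OF that triv] subgroup.one_closed[OF that] by simp
  have "\<phi> \<one>\<^bsub>fgrp E\<^esub> = \<one>\<^bsub>fgrp E\<^esub>"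
    using fhom_mult[OF \<phi>, of "\<one>\<^bsub>fgrp E\<^esub>" "\<one>\<^bsub>fgrp E\<^esub>"] subgroup.one_closed[OF fhom_subgroup(1)[OF \<phi>]]
      subgroup.mem_carrier[OF fhom_subgroup(2)[OF \<phi>] fhom_mem[OF \<phi>]] by simp
  then show "\<exists>\<psi>\<in>fhom E (U <#>\<^bsub>fgrp E\<^esub> {\<one>\<^bsub>fgrp E\<^esub>}) (V <#>\<^bsub>fgrp E\<^esub> {\<one>\<^bsub>fgrp E\<^esub>}).
      restrict \<psi> U = \<phi> \<and> \<psi> ` {\<one>\<^bsub>fgrp E\<^esub>} = {\<one>\<^bsub>fgrp E\<^esub>}"
    using \<phi> extensional_restrict[OF fhom_ext[OF \<phi>]]
    unfolding 1[OF fhom_subgroup(1)[OF \<phi>]] 1[OF fhom_subgroup(2)[OF \<phi>]] by auto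
qed

text \<open>A morphism is extended over \<open>Q\<close> first, and the extension is extended over \<open>R\<close>.\<close>

lemma fnormal_set_mult:
  assumes Q: "fnormal E Q" and R: "fnormal E R"
  shows "fnormal E (Q <#>\<^bsub>fgrp E\<^esub> R)"
  unfolding fnormal_iff
proof (intro conjI allI ballI)
  note QG = fnormal_subgroup[OF Q] and RG = fnormal_subgroup[OF R]
  have NQ: "normalizer (fgrp E) Q = carrier (fgrp E)" and NR: "normalizer (fgrp E) R = carrier (fgrp E)"
    using Q R fnormal_iff by auto
  show QRG: "subgroup (Q <#>\<^bsub>fgrp E\<^esub> R) (fgrp E)"
    using subgroup_set_mult[OF QG RG] subgroup.subset[OF QG] NR by simp
  have "g \<in> normalizer (fgrp E) (Q <#>\<^bsub>fgrp E\<^esub> R)" if g: "g \<in> carrier (fgrp E)" for g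
    unfolding mem_normalizer[OF QRG]
  proof (intro conjI ballI g)
    fix y assume "y \<in> Q <#>\<^bsub>fgrp E\<^esub> R"
    then obtain u q where uq: "u \<in> Q" "q \<in> R" "y = u \<otimes>\<^bsub>fgrp E\<^esub> q"
      by (auto simp: set_mult_def)
    have uqc: "u \<in> carrier (fgrp E)" "q \<in> carrier (fgrp E)"
      using uq subgroup.mem_carrier[OF QG] subgroup.mem_carrier[OF RG] by auto
    have "g \<otimes>\<^bsub>fgrp E\<^esub> y \<otimes>\<^bsub>fgrp E\<^esub> inv\<^bsub>fgrp E\<^esub> g
        = (g \<otimes>\<^bsub>fgrp E\<^esub> u \<otimes>\<^bsub>fgrp E\<^esub> inv\<^bsub>fgrp E\<^esub> g)
            \<otimes>\<^bsub>fgrp E\<^esub> (g \<otimes>\<^bsub>fgrp E\<^esub> q \<otimes>\<^bsub>fgrp E\<^esub> inv\<^bsub>fgrp E\<^esub> g)"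
      unfolding uq(3) by (rule conj_mult_distrib[OF g uqc])
    moreover have "g \<otimes>\<^bsub>fgrp E\<^esub> u \<otimes>\<^bsub>fgrp E\<^esub> inv\<^bsub>fgrp E\<^esub> g \<in> Q"
      using mem_normalizer[OF QG] NQ g uq(1) by blast
    moreover have "g \<otimes>\<^bsub>fgrp E\<^esub> q \<otimes>\<^bsub>fgrp E\<^esub> inv\<^bsub>fgrp E\<^esub> g \<in> R"
      using mem_normalizer[OF RG] NR g uq(2) by blast
    ultimately show "g \<otimes>\<^bsub>fgrp E\<^esub> y \<otimes>\<^bsub>fgrp E\<^esub> inv\<^bsub>fgrp E\<^esub> g \<in> Q <#>\<^bsub>fgrp E\<^esub> R"
      by (auto simp: set_mult_def)
  qed
  then show "normalizer (fgrp E) (Q <#>\<^bsub>fgrp E\<^esub> R) = carrier (fgrp E)"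
    using subgroup.subset[OF subgroup_normalizer[OF QRG]] by blast
  fix U V \<phi> assume \<phi>: "\<phi> \<in> fhom E U V"
  note UG = fhom_subgroup(1)[OF \<phi>] and VG = fhom_subgroup(2)[OF \<phi>]
  obtain \<psi> where \<psi>: "\<psi> \<in> fhom E (U <#>\<^bsub>fgrp E\<^esub> Q) (V <#>\<^bsub>fgrp E\<^esub> Q)"
    "\<And>x. x \<in> U \<Longrightarrow> \<psi> x = \<phi> x" "\<psi> ` Q = Q"
    using fnormal_extend[OF Q \<phi>] by metis
  note UQ = fhom_subgroup(1)[OF \<psi>(1)]
  obtain \<theta> where \<theta>: "\<theta> \<in> fhom E (U <#>\<^bsub>fgrp E\<^esub> Q <#>\<^bsub>fgrp E\<^esub> R) (V <#>\<^bsub>fgrp E\<^esub> Q <#>\<^bsub>fgrp E\<^esub> R)"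
    "\<And>x. x \<in> U <#>\<^bsub>fgrp E\<^esub> Q \<Longrightarrow> \<theta> x = \<psi> x" "\<theta> ` R = R"
    using fnormal_extend[OF R \<psi>(1)] by metis
  have assoc: "W <#>\<^bsub>fgrp E\<^esub> Q <#>\<^bsub>fgrp E\<^esub> R = W <#>\<^bsub>fgrp E\<^esub> (Q <#>\<^bsub>fgrp E\<^esub> R)"
    if "subgroup W (fgrp E)" for W
    by (rule set_mult_assoc[OF subgroup.subset[OF that] subgroup.subset[OF QG] subgroup.subset[OF RG]])
  have "restrict \<theta> U = \<phi>"
    using \<theta>(2) \<psi>(2) subset_set_mult(1)[OF UG QG] extensional_arb[OF fhom_ext[OF \<phi>]]
    by (auto simp: fun_eq_iff)
  moreover have "\<theta> ` (Q <#>\<^bsub>fgrp E\<^esub> R) = Q <#>\<^bsub>fgrp E\<^esub> R"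
  proof -
    have "\<theta> ` Q = Q"
      using \<theta>(2) \<psi>(3) subset_set_mult(2)[OF UG QG] by (metis (no_types, lifting) image_cong subsetD)
    have "Q \<subseteq> U <#>\<^bsub>fgrp E\<^esub> Q <#>\<^bsub>fgrp E\<^esub> R" "R \<subseteq> U <#>\<^bsub>fgrp E\<^esub> Q <#>\<^bsub>fgrp E\<^esub> R"
      using subset_set_mult[OF UQ RG] subset_set_mult(2)[OF UG QG] by blast+
    from fhom_set_mult_image[OF \<theta>(1) this]
    have "\<theta> ` (Q <#>\<^bsub>fgrp E\<^esub> R) = \<theta> ` Q <#>\<^bsub>fgrp E\<^esub> \<theta> ` R" .
    then show ?thesis using \<open>\<theta> ` Q = Q\<close> \<theta>(3) by simp
  qed
  ultimately show "\<exists>\<psi>\<in>fhom E (U <#>\<^bsub>fgrp E\<^esub> (Q <#>\<^bsub>fgrp E\<^esub> R)) (V <#>\<^bsub>fgrp E\<^esub> (Q <#>\<^bsub>fgrp E\<^esub> R)).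
      restrict \<psi> U = \<phi> \<and> \<psi> ` (Q <#>\<^bsub>fgrp E\<^esub> R) = Q <#>\<^bsub>fgrp E\<^esub> R"
    using \<theta>(1) unfolding assoc[OF UG] assoc[OF VG] by blast
qed

text \<open>A normal subgroup \<open>C\<close> of largest order contains every normal \<open>Q\<close>, because the product \<open>C Q\<close> is
normal, and so equal to \<open>C\<close>.\<close>

lemma fcore_greatest: "fnormal E (fcore E)" "fnormal E Q \<Longrightarrow> Q \<subseteq> fcore E"
proof -
  have "card Q < Suc (card (carrier (fgrp E)))" if "fnormal E Q" for Q
    using card_mono[OF finite_fgrp subgroup.subset[OF fnormal_subgroup[OF that]]] by simp
  then obtain C where C: "fnormal E C" "\<forall>Q. fnormal E Q \<longrightarrow> card Q \<le> card C"
    using ex_has_greatest_nat[of "fnormal E" _ card] fnormal_trivial by blast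
  have max: "Q \<subseteq> C" if Q: "fnormal E Q" for Q
  proof -
    note CG = fnormal_subgroup[OF C(1)] and QG = fnormal_subgroup[OF Q]
    have CQ: "fnormal E (C <#>\<^bsub>fgrp E\<^esub> Q)" by (rule fnormal_set_mult[OF C(1) Q])
    have "C = C <#>\<^bsub>fgrp E\<^esub> Q"
      using card_seteq[OF finite_subgroup[OF fnormal_subgroup[OF CQ]] subset_set_mult(1)[OF CG QG]]
        C(2) CQ by blast
    then show ?thesis using subset_set_mult(2)[OF CG QG] by simp
  qed
  have "fcore E = C"
    unfolding fcore_def by (rule Greatest_equality) (use C(1) max in auto)
  then show "fnormal E (fcore E)" "fnormal E Q \<Longrightarrow> Q \<subseteq> fcore E" using C(1) max by auto
qed

end

context fusion_system
begin

text \<open>The extension to \<open>U Q\<close> that places a morphism in \<open>N(Q)\<close> is itself a morphism of \<open>N(Q)\<close>, as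
\<open>U Q Q = U Q\<close>.\<close>

lemma fnormal_fnormalizer:
  assumes Q: "subgroup Q (fgrp E)"
  shows "fnormal (fnormalizer E Q) Q"
proof -
  let ?N = "normalizer (fgrp E) Q"
  let ?F = "fnormalizer E Q"
  interpret N: fusion_system p ?F by (rule fusion_system_fnormalizer[OF Q])
  have QN: "subgroup Q (fgrp ?F)"
    using subgroup_fnormalizer_iff[OF Q] Q subset_normalizer[OF Q] by blast
  have mult: "W <#>\<^bsub>fgrp ?F\<^esub> Q = W <#>\<^bsub>fgrp E\<^esub> Q" for W by (simp add: fgrp_fnormalizer)
  have "normalizer (fgrp ?F) Q = carrier (fgrp ?F)"
  proof
    show "carrier (fgrp ?F) \<subseteq> normalizer (fgrp ?F) Q"
    proof
      fix g assume "g \<in> carrier (fgrp ?F)"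
      then have g: "g \<in> ?N" by (simp add: fgrp_fnormalizer)
      have "g \<otimes>\<^bsub>fgrp ?F\<^esub> x \<otimes>\<^bsub>fgrp ?F\<^esub> inv\<^bsub>fgrp ?F\<^esub> g \<in> Q" if "x \<in> Q" for x
        using g that mem_normalizer[OF Q] m_inv_consistent[OF subgroup_normalizer[OF Q] g]
        by (simp add: fgrp_fnormalizer)
      then show "g \<in> normalizer (fgrp ?F) Q"
        using N.mem_normalizer[OF QN] \<open>g \<in> carrier (fgrp ?F)\<close> by blast
    qed
  qed (rule subgroup.subset[OF N.subgroup_normalizer[OF QN]])
  moreover have "\<exists>\<psi>\<in>fhom ?F (U <#>\<^bsub>fgrp ?F\<^esub> Q) (V <#>\<^bsub>fgrp ?F\<^esub> Q). restrict \<psi> U = \<phi> \<and> \<psi> ` Q = Q"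
    if \<phi>: "\<phi> \<in> fhom ?F U V" for \<phi> U V
  proof -
    obtain \<psi> where \<psi>: "\<psi> \<in> fhom E (U <#>\<^bsub>fgrp E\<^esub> Q) (V <#>\<^bsub>fgrp E\<^esub> Q)" "restrict \<psi> U = \<phi>" "\<psi> ` Q = Q"
      by (rule fhom_fnormalizer_extend[OF Q \<phi>])
    note UN = fhom_fnormalizerD(2)[OF Q \<phi>] and VN = fhom_fnormalizerD(3)[OF Q \<phi>]
    note UG = fhom_subgroup(1)[OF fhom_fnormalizerD(1)[OF Q \<phi>]]
      and VG = fhom_subgroup(2)[OF fhom_fnormalizerD(1)[OF Q \<phi>]]
    have QN': "W <#>\<^bsub>fgrp E\<^esub> Q \<subseteq> ?N" if "W \<subseteq> ?N" for W
      using that subset_normalizer[OF Q] subgroup.m_closed[OF subgroup_normalizer[OF Q]]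
      by (auto simp: set_mult_def)
    have idem: "W <#>\<^bsub>fgrp E\<^esub> Q <#>\<^bsub>fgrp E\<^esub> Q = W <#>\<^bsub>fgrp E\<^esub> Q"
      if "subgroup W (fgrp E)" "W \<subseteq> ?N" for W
      using set_mult_absorb[OF subgroup_set_mult[OF that(1) Q that(2)] Q subset_set_mult(2)[OF that(1) Q]] .
    have "\<psi> \<in> fhom ?F (U <#>\<^bsub>fgrp E\<^esub> Q) (V <#>\<^bsub>fgrp E\<^esub> Q)"
      by (rule fhom_fnormalizerI[OF Q \<psi>(1) QN'[OF UN] QN'[OF VN], of \<psi>])
        (simp_all add: idem UG VG UN VN \<psi> extensional_restrict[OF fhom_ext[OF \<psi>(1)]])
    then show ?thesis using \<psi>(2,3) unfolding mult by blast
  qed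
  ultimately show ?thesis using N.fnormal_iff QN by blast
qed

end

context fusion_system
begin

lemma weakly_centric_radical_fgrp: "weakly_centric_radical E (carrier (fgrp E))"
proof -
  let ?S = "carrier (fgrp E)"
  interpret N: fusion_system p "fnormalizer E ?S" by (rule fusion_system_fnormalizer[OF subgroup_self])
  have "fcore (fnormalizer E ?S) \<subseteq> normalizer (fgrp E) ?S"
    using subgroup.subset[OF N.fnormal_subgroup[OF N.fcore_greatest(1)]] by (simp add: fgrp_fnormalizer)
  then have "fcore (fnormalizer E ?S) \<subseteq> ?S"
    using subgroup.subset[OF subgroup_normalizer[OF subgroup_self]] by blast
  moreover have "?S \<subseteq> fcore (fnormalizer E ?S)"
    by (rule N.fcore_greatest(2)[OF fnormal_fnormalizer[OF subgroup_self]])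
  ultimately show ?thesis using subgroup_self by (simp add: weakly_centric_radical_def)
qed


section \<open>Essential and weakly centric-radical subgroups\<close>

lemma fhom_preserves_normalizer:
  assumes \<beta>: "\<beta> \<in> fhom E K L" and Q: "subgroup Q (fgrp E)" "Q \<subseteq> K" "\<beta> ` Q = Q"
    and g: "g \<in> K" "g \<in> normalizer (fgrp E) Q"
  shows "\<beta> g \<in> normalizer (fgrp E) Q"
  unfolding mem_normalizer[OF Q(1)]
proof (intro conjI ballI)
  show "\<beta> g \<in> carrier (fgrp E)"
    using subgroup.mem_carrier[OF fhom_subgroup(2)[OF \<beta>] fhom_mem[OF \<beta> g(1)]] .
  fix x assume "x \<in> Q"
  then obtain y where y: "y \<in> Q" "x = \<beta> y" using Q(3) by blast
  have "g \<otimes>\<^bsub>fgrp E\<^esub> y \<otimes>\<^bsub>fgrp E\<^esub> inv\<^bsub>fgrp E\<^esub> g \<in> Q"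
    using g(2) y(1) mem_normalizer[OF Q(1)] by blast
  then have "\<beta> (g \<otimes>\<^bsub>fgrp E\<^esub> y \<otimes>\<^bsub>fgrp E\<^esub> inv\<^bsub>fgrp E\<^esub> g) \<in> Q" using Q(3) by blast
  then show "\<beta> g \<otimes>\<^bsub>fgrp E\<^esub> x \<otimes>\<^bsub>fgrp E\<^esub> inv\<^bsub>fgrp E\<^esub> \<beta> g \<in> Q"
    using fhom_conj[OF \<beta> g(1)] y Q(2) by auto
qed

lemma set_mult_absorb_left:
  assumes "subgroup M (fgrp E)" "subgroup Q (fgrp E)" "Q \<subseteq> M"
  shows "Q <#>\<^bsub>fgrp E\<^esub> M = M"
proof
  show "Q <#>\<^bsub>fgrp E\<^esub> M \<subseteq> M"
    using assms(3) subgroup.m_closed[OF assms(1)] by (auto simp: set_mult_def)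
qed (rule subset_set_mult(2)[OF assms(2,1)])

lemma fessentialD:
  assumes "Q \<in> fessential p E"
  obtains H where "subgroup Q (fgrp E)" "fully_normalized E Q" "fcentric E Q"
    "strongly_embedded p H (fout E Q)"
  using assms by (auto simp: fessential_def)

text \<open>Let \<open>K = Q O\<^sub>p(E)\<close>. The automorphisms of \<open>Q\<close> extend to \<open>K\<close>, and the extensions stabilise \<open>N\<^sub>K(Q)\<close>.
So \<open>N\<^sub>K(Q) = Q\<close>, and \<open>K = Q\<close> because normalizers grow.\<close>

lemma fcore_subset_essential:
  assumes "Q \<in> fessential p E"
  shows "fcore E \<subseteq> Q"
proof -
  obtain H where Q: "subgroup Q (fgrp E)" "fcentric E Q" "strongly_embedded p H (fout E Q)"
    using fessentialD[OF assms] .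
  have C: "fnormal E (fcore E)" by (rule fcore_greatest(1))
  note CG = fnormal_subgroup[OF C]
  let ?K = "Q <#>\<^bsub>fgrp E\<^esub> fcore E"
  have K: "subgroup ?K (fgrp E)"
    by (rule subgroup_set_mult[OF Q(1) CG])
      (use C subgroup.subset[OF Q(1)] in \<open>simp add: fnormal_iff\<close>)
  have QK: "Q \<subseteq> ?K" and CK: "fcore E \<subseteq> ?K" using subset_set_mult[OF Q(1) CG] by auto
  let ?M = "?K \<inter> normalizer (fgrp E) Q"
  have M: "subgroup ?M (fgrp E)" by (rule subgroups_Inter_pair[OF K subgroup_normalizer[OF Q(1)]])
  have "?M = Q"
  proof (rule aut_invariant_overgroup_eq[OF Q M])
    show "Q \<subseteq> ?M" using QK subset_normalizer[OF Q(1)] by blast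
    show "?M \<subseteq> normalizer (fgrp E) Q" by blast
    fix \<alpha> assume \<alpha>: "\<alpha> \<in> fhom E Q Q"
    obtain \<psi> where \<psi>: "\<psi> \<in> fhom E ?K ?K" "\<And>x. x \<in> Q \<Longrightarrow> \<psi> x = \<alpha> x"
      using fnormal_extend[OF C \<alpha>] by metis
    have \<psi>Q: "\<psi> ` Q = Q" using \<psi>(2) fhom_image_eq[OF \<alpha>] by simp
    have "\<psi> ` ?M \<subseteq> ?M"
      using fhom_mem[OF \<psi>(1)] fhom_preserves_normalizer[OF \<psi>(1) Q(1) QK \<psi>Q] by blast
    then have "restrict \<psi> ?M \<in> fhom E ?M ?M"
      by (intro fhom_restrict[OF \<psi>(1) M _ M]) blast+
    moreover have "\<forall>x\<in>Q. restrict \<psi> ?M x = \<alpha> x"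
      using \<psi>(2) QK subset_normalizer[OF Q(1)] by auto
    ultimately show "\<exists>\<psi>\<in>fhom E ?M ?M. \<forall>x\<in>Q. \<psi> x = \<alpha> x" by blast
  qed
  then have "?K = Q"
    using normalizer_proper_overgroup[OF Q(1) K QK] by blast
  then show ?thesis using CK by simp
qed

text \<open>All automorphisms of \<open>Q\<close> are morphisms of \<open>N(Q)\<close>, so they extend to \<open>O\<^sub>p(N(Q)) \<ge> Q\<close>.\<close>

lemma essential_weakly_centric_radical:
  assumes "Q \<in> fessential p E"
  shows "weakly_centric_radical E Q"
proof -
  obtain H where Q: "subgroup Q (fgrp E)" "fcentric E Q" "strongly_embedded p H (fout E Q)"
    using fessentialD[OF assms] .
  let ?F = "fnormalizer E Q"
  interpret N: fusion_system p ?F by (rule fusion_system_fnormalizer[OF Q(1)])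
  let ?M = "fcore ?F"
  note MN = N.fcore_greatest(1)
  have M: "subgroup ?M (fgrp E)" "?M \<subseteq> normalizer (fgrp E) Q"
    using N.fnormal_subgroup[OF MN] unfolding subgroup_fnormalizer_iff[OF Q(1)] by auto
  have QM: "Q \<subseteq> ?M" by (rule N.fcore_greatest(2)[OF fnormal_fnormalizer[OF Q(1)]])
  have "?M = Q"
  proof (rule aut_invariant_overgroup_eq[OF Q M(1) QM M(2)])
    fix \<alpha> assume \<alpha>: "\<alpha> \<in> fhom E Q Q"
    have "\<alpha> \<in> fhom ?F Q Q"
      by (rule fhom_fnormalizerI[OF Q(1) \<alpha> subset_normalizer[OF Q(1)] subset_normalizer[OF Q(1)], of \<alpha>])
        (use \<alpha> in \<open>simp_all add: set_mult_absorb[OF Q(1) Q(1)] fhom_image_eq extensional_restrict[OF fhom_ext]\<close>)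
    then obtain \<psi> where \<psi>: "\<psi> \<in> fhom ?F (Q <#>\<^bsub>fgrp ?F\<^esub> ?M) (Q <#>\<^bsub>fgrp ?F\<^esub> ?M)"
      "\<And>x. x \<in> Q \<Longrightarrow> \<psi> x = \<alpha> x"
      using N.fnormal_extend[OF MN] by metis
    have "Q <#>\<^bsub>fgrp ?F\<^esub> ?M = ?M"
      using set_mult_absorb_left[OF M(1) Q(1) QM] by (simp add: fgrp_fnormalizer)
    then have "\<psi> \<in> fhom E ?M ?M" using fhom_fnormalizerD(1)[OF Q(1)] \<psi>(1) by simp
    then show "\<exists>\<psi>\<in>fhom E ?M ?M. \<forall>x\<in>Q. \<psi> x = \<alpha> x" using \<psi>(2) by blast
  qed
  then show ?thesis using Q(1) by (simp add: weakly_centric_radical_def)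
qed

lemma normalizer_fgrp: "normalizer (fgrp E) (carrier (fgrp E)) = carrier (fgrp E)"
  using subset_normalizer[OF subgroup_self] subgroup.subset[OF subgroup_normalizer[OF subgroup_self]]
  by blast

end

context saturated_fusion_system
begin

text \<open>On \<open>S\<close>, inner automorphisms are all of \<open>Aut\<^sub>S(S)\<close>, a Sylow subgroup of \<open>Aut(S)\<close>. So \<open>Out(S)\<close> has order
prime to \<open>p\<close>, whereas \<open>p\<close> divides the order of a strongly \<open>p\<close>-embedded subgroup.\<close>

lemma fgrp_not_essential: "carrier (fgrp E) \<notin> fessential p E"
proof
  let ?S = "carrier (fgrp E)"
  assume "?S \<in> fessential p E"
  then obtain H where R: "fully_normalized E ?S" and H: "strongly_embedded p H (fout E ?S)"
    using fessentialD by blast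
  interpret A: group "faut E ?S" by (rule group_faut[OF subgroup_self])
  interpret O: group "fout E ?S"
    unfolding fout_def by (rule normal.factorgroup_is_group[OF finn_normal[OF subgroup_self]])
  have "finn E ?S = faut_grp E ?S" by (simp add: finn_def faut_grp_def normalizer_fgrp)
  then have c: "card (finn E ?S) = p ^ multiplicity p (order (faut E ?S))"
    using fully_normalized_sylow[OF R] by (simp add: sylow_subgroup_def)
  have "p dvd card H" "subgroup H (fout E ?S)" using H by (auto simp: strongly_embedded_def)
  then have "p dvd order (fout E ?S)" using O.lagrange by (metis dvd_mult)
  moreover have "order (fout E ?S) * card (finn E ?S) = order (faut E ?S)"
    using A.lagrange[OF normal_imp_subgroup[OF finn_normal[OF subgroup_self]]]
    by (simp add: fout_def FactGroup_def order_def)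
  ultimately have "p ^ Suc (multiplicity p (order (faut E ?S))) dvd order (faut E ?S)"
    using c by (metis mult_dvd_mono dvd_refl power_Suc)
  moreover have "order (faut E ?S) \<noteq> 0" using finite_faut A.order_gt_0_iff_finite by simp
  moreover have "\<not> is_unit p" using prime_p not_prime_unit by blast
  ultimately have "Suc (multiplicity p (order (faut E ?S))) \<le> multiplicity p (order (faut E ?S))"
    by (intro multiplicity_geI)
  then show False by simp
qed

text \<open>A morphism of \<open>N(R)\<close> extends to an automorphism of \<open>S\<close> that maps \<open>R\<close> to itself, and therefore \<open>N\<^sub>S(R)\<close>
to itself. So \<open>N\<^sub>S(R)\<close> is normal in \<open>N(R)\<close>, which makes the core of \<open>N(R)\<close> larger than \<open>R\<close>.\<close>

lemma not_weakly_centric_radical_above_essentials: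
  assumes ess: "\<And>Q. Q \<in> fessential p E \<Longrightarrow> card Q < card R"
    and R: "subgroup R (fgrp E)" "R \<noteq> carrier (fgrp E)"
  shows "\<not> weakly_centric_radical E R"
proof -
  let ?S = "carrier (fgrp E)" and ?N = "normalizer (fgrp E) R" and ?F = "fnormalizer E R"
  interpret N: fusion_system p ?F by (rule fusion_system_fnormalizer[OF R(1)])
  note NG = subgroup_normalizer[OF R(1)] and RN = subset_normalizer[OF R(1)]
  have cF: "carrier (fgrp ?F) = ?N" by (simp add: fgrp_fnormalizer)
  have absorb: "U <#>\<^bsub>fgrp ?F\<^esub> ?N = ?N" if "subgroup U (fgrp ?F)" for U
    using N.set_mult_absorb_left[OF N.subgroup_self that] subgroup.subset[OF that] unfolding cF by blast
  have "fnormal ?F ?N"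
    unfolding N.fnormal_iff
  proof (intro conjI allI ballI)
    show "subgroup ?N (fgrp ?F)" using N.subgroup_self unfolding cF .
    show "normalizer (fgrp ?F) ?N = carrier (fgrp ?F)" using N.normalizer_fgrp unfolding cF .
    fix U V \<phi> assume \<phi>: "\<phi> \<in> fhom ?F U V"
    obtain \<psi> where \<psi>: "\<psi> \<in> fhom E (U <#>\<^bsub>fgrp E\<^esub> R) (V <#>\<^bsub>fgrp E\<^esub> R)" "restrict \<psi> U = \<phi>" "\<psi> ` R = R"
      by (rule fhom_fnormalizer_extend[OF R(1) \<phi>])
    have UG: "subgroup U (fgrp E)" and UN: "U \<subseteq> ?N"
      using fhom_subgroup(1)[OF fhom_fnormalizerD(1)[OF R(1) \<phi>]] fhom_fnormalizerD(2)[OF R(1) \<phi>] by auto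
    have UR: "U \<subseteq> U <#>\<^bsub>fgrp E\<^esub> R" "R \<subseteq> U <#>\<^bsub>fgrp E\<^esub> R" using subset_set_mult[OF UG R(1)] by auto
    have "card R \<le> card (U <#>\<^bsub>fgrp E\<^esub> R)"
      using UR(2) finite_subgroup[OF fhom_subgroup(1)[OF \<psi>(1)]] card_mono by blast
    then obtain \<beta> where \<beta>: "\<beta> \<in> fhom E ?S ?S" "\<forall>x\<in>U <#>\<^bsub>fgrp E\<^esub> R. \<beta> x = \<psi> x"
      using extends_to_fgrp_if_no_large_essential[OF ess \<psi>(1)] by blast
    have \<beta>R: "\<beta> ` R = R"
    proof -
      have "\<beta> ` R = \<psi> ` R" using \<beta>(2) UR(2) by (intro image_cong) auto
      then show ?thesis using \<psi>(3) by simp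
    qed
    have "\<beta> ` ?N \<subseteq> ?N"
      using fhom_preserves_normalizer[OF \<beta>(1) R(1) subgroup.subset[OF R(1)] \<beta>R]
        subgroup.mem_carrier[OF NG] by blast
    then have \<beta>N: "restrict \<beta> ?N \<in> fhom E ?N ?N"
      by (rule fhom_restrict[OF \<beta>(1) NG subgroup.subset[OF NG] NG])
    have im: "restrict \<beta> ?N ` R = R"
    proof -
      have "restrict \<beta> ?N ` R = \<beta> ` R" using RN by (intro image_cong) auto
      then show ?thesis using \<beta>R by simp
    qed
    have "restrict \<beta> ?N \<in> fhom ?F ?N ?N"
      by (rule fhom_fnormalizerI[OF R(1) \<beta>N subset_refl subset_refl, of "restrict \<beta> ?N"])
        (use \<beta>N im in \<open>simp_all add: set_mult_absorb[OF NG R(1) RN]\<close>)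
    moreover have "restrict (restrict \<beta> ?N) U = \<phi>"
    proof -
      have "restrict (restrict \<beta> ?N) U = restrict \<psi> U"
        using \<beta>(2) UR(1) UN by (intro ext) (auto simp: restrict_def)
      then show ?thesis using \<psi>(2) by simp
    qed
    moreover have "restrict \<beta> ?N ` ?N = ?N" by (rule fhom_image_eq[OF \<beta>N])
    ultimately show "\<exists>\<psi>\<in>fhom ?F (U <#>\<^bsub>fgrp ?F\<^esub> ?N) (V <#>\<^bsub>fgrp ?F\<^esub> ?N). restrict \<psi> U = \<phi> \<and> \<psi> ` ?N = ?N"
      unfolding absorb[OF N.fhom_subgroup(1)[OF \<phi>]] absorb[OF N.fhom_subgroup(2)[OF \<phi>]] by blast
  qed
  then have "?N \<subseteq> fcore ?F" by (rule N.fcore_greatest(2))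
  moreover obtain g where "g \<in> ?N" "g \<notin> R"
    using normalizer_proper_overgroup[OF R(1) subgroup_self subgroup.subset[OF R(1)] R(2)] .
  ultimately show ?thesis by (auto simp: weakly_centric_radical_def)
qed

lemma fcore_eq_fgrp_if_no_essential:
  assumes "fessential p E = {}"
  shows "fcore E = carrier (fgrp E)"
proof -
  let ?S = "carrier (fgrp E)"
  have "fnormal E ?S"
    unfolding fnormal_iff
  proof (intro conjI allI ballI)
    show "subgroup ?S (fgrp E)" by (rule subgroup_self)
    show "normalizer (fgrp E) ?S = ?S" by (rule normalizer_fgrp)
    fix U V \<phi> assume \<phi>: "\<phi> \<in> fhom E U V"
    obtain \<beta> where \<beta>: "\<beta> \<in> fhom E ?S ?S" "\<forall>x\<in>U. \<beta> x = \<phi> x"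
      using extends_to_fgrp_if_no_large_essential[of 0, OF _ \<phi>] assms by auto
    have "restrict \<beta> U = \<phi>"
      using \<beta>(2) extensional_arb[OF fhom_ext[OF \<phi>]] by (auto simp: restrict_def)
    moreover have "W <#>\<^bsub>fgrp E\<^esub> ?S = ?S" if "subgroup W (fgrp E)" for W
      by (rule set_mult_absorb_left[OF subgroup_self that subgroup.subset[OF that]])
    ultimately show "\<exists>\<psi>\<in>fhom E (U <#>\<^bsub>fgrp E\<^esub> ?S) (V <#>\<^bsub>fgrp E\<^esub> ?S). restrict \<psi> U = \<phi> \<and> \<psi> ` ?S = ?S"
      using \<beta>(1) fhom_image_eq[OF \<beta>(1)] fhom_subgroup[OF \<phi>] by auto
  qed
  then show ?thesis
    using fcore_greatest subgroup.subset[OF fnormal_subgroup[OF fcore_greatest(1)]] by blast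
qed

end

section \<open>The weakly local rank\<close>

context fusion_system
begin

text \<open>The chain \<open>O\<^sub>p(E) < S\<close> has length 1, and \<open>O\<^sub>p(E) < R < N\<^sub>S(R)\<close> has length 2 for a weakly
centric-radical \<open>R < S\<close>, as the full group of \<open>N(R)\<close> is weakly centric-radical in \<open>N(R)\<close>. Conversely,
the member \<open>Q\<^sub>1\<close> of a chain of length at least 2 lies properly between \<open>O\<^sub>p(E)\<close> and \<open>S\<close>. Here \<open>N(\<sigma>\<^sub>0) = E\<close>, because \<open>Q\<^sub>0\<close>
is normal in \<open>E\<close>.\<close>

lemma weakly_local_rank_eq_1_iff:
  "weakly_local_rank E = 1 \<longleftrightarrow> fcore E \<noteq> carrier (fgrp E) \<and>
     (\<forall>R. fcore E \<subset> R \<and> weakly_centric_radical E R \<longrightarrow> R = carrier (fgrp E))"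
  (is "_ \<longleftrightarrow> ?proper \<and> ?no_mid")
proof -
  let ?S = "carrier (fgrp E)"
  let ?chain = "weakly_centric_radical_chain E"
  define L where "L = {length Qs - 1 |Qs. ?chain Qs}"
  have C: "fnormal E (fcore E)" by (rule fcore_greatest(1))
  have CE: "fnormalizer E (fcore E) = E" using C by (simp add: fnormal_def)
  have CS: "subgroup (fcore E) (fgrp E)" by (rule fnormal_subgroup[OF C])
  \<comment> \<open>The maximum in the definition of the rank is over a finite set, since chains are strict.\<close>
  have "length Qs - 1 \<le> card (Pow ?S)" if "?chain Qs" for Qs
  proof -
    have "sorted_wrt (\<noteq>) Qs"
      using that by (auto simp: weakly_centric_radical_chain_def intro: sorted_wrt_mono_rel[of Qs "(\<subset>)"])
    then have "distinct Qs" by (induction Qs) auto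
    moreover have "set Qs \<subseteq> Pow ?S"
      using that subgroup.subset by (force simp: weakly_centric_radical_chain_def)
    ultimately show ?thesis
      using card_mono[of "Pow ?S" "set Qs"] finite_fgrp by (simp add: distinct_card)
  qed
  then have "L \<subseteq> {..card (Pow ?S)}" by (auto simp: L_def)
  then have fin: "finite L" by (rule finite_subset) simp
  have L0: "0 \<in> L"
    using CS CE by (auto simp: L_def weakly_centric_radical_chain_def intro!: exI[of _ "[fcore E]"])
  have L1: "1 \<in> L" if "?proper"
  proof -
    have "?chain [fcore E, ?S]"
      using that subgroup.subset[OF CS] CS CE subgroup_self weakly_centric_radical_fgrp
      by (auto simp: weakly_centric_radical_chain_def chain_normalizer_def less_Suc_eq)
    then show ?thesis by (force simp: L_def)
  qed
  have L2: "2 \<in> L" if R: "fcore E \<subset> R" "weakly_centric_radical E R" "R \<noteq> ?S" for R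
  proof -
    have RG: "subgroup R (fgrp E)" using R(2) by (simp add: weakly_centric_radical_def)
    let ?N = "normalizer (fgrp E) R"
    interpret N: fusion_system p "fnormalizer E R" by (rule fusion_system_fnormalizer[OF RG])
    have "weakly_centric_radical (fnormalizer E R) ?N"
      using N.weakly_centric_radical_fgrp by (simp add: fgrp_fnormalizer)
    moreover obtain g where "g \<in> ?N" "g \<notin> R"
      using normalizer_proper_overgroup[OF RG subgroup_self subgroup.subset[OF RG] R(3)] .
    then have "R \<subset> ?N" using subset_normalizer[OF RG] by blast
    ultimately have "?chain [fcore E, R, ?N]"
      using R(1,2) RG CS CE subgroup_normalizer[OF RG]
      by (auto simp: weakly_centric_radical_chain_def chain_normalizer_def less_Suc_eq)
    then show ?thesis by (force simp: L_def)
  qed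
  have step: "?proper \<and> fcore E \<subset> Qs ! 1 \<and> weakly_centric_radical E (Qs ! 1)"
    if "?chain Qs" "2 \<le> length Qs" for Qs
  proof -
    have Q: "fcore E \<subset> Qs ! 1" "weakly_centric_radical (chain_normalizer E (take 1 Qs)) (Qs ! 1)"
      "fnormalizer E (Qs ! 0) = E" "subgroup (Qs ! 1) (fgrp E)"
      using that by (auto simp: weakly_centric_radical_chain_def)
    have "take 1 Qs = [Qs ! 0]" using that(2) by (cases Qs) auto
    then have "weakly_centric_radical E (Qs ! 1)" using Q(2,3) by (simp add: chain_normalizer_def)
    then show ?thesis using Q(1) subgroup.subset[OF Q(4)] by blast
  qed
  have step2: "\<not> ?no_mid" if "?chain Qs" "3 \<le> length Qs" for Qs
  proof -
    have "Qs ! 1 \<subset> Qs ! 2"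
      using that by (auto simp: weakly_centric_radical_chain_def sorted_wrt_iff_nth_less)
    moreover have "subgroup (Qs ! 2) (fgrp E)"
      using that by (auto simp: weakly_centric_radical_chain_def)
    ultimately have "Qs ! 1 \<noteq> ?S" using subgroup.subset by blast
    then show ?thesis using step[OF that(1)] that(2) by auto
  qed
  have "weakly_local_rank E = Max L" by (simp add: weakly_local_rank_def L_def)
  moreover have "Max L = 1 \<longleftrightarrow> 1 \<in> L \<and> (\<forall>k\<in>L. k \<le> 1)"
    using fin L0 by (metis Max_ge Max_in Max_eqI empty_iff)
  moreover have "1 \<in> L \<and> (\<forall>k\<in>L. k \<le> 1) \<longleftrightarrow> ?proper \<and> ?no_mid"
  proof
    assume *: "1 \<in> L \<and> (\<forall>k\<in>L. k \<le> 1)"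
    then obtain Qs where "?chain Qs" "length Qs - 1 = 1" by (auto simp: L_def)
    then have ?proper using step by force
    moreover have ?no_mid using L2 * by (metis Suc_1 not_less_eq_eq One_nat_def le_refl)
    ultimately show "?proper \<and> ?no_mid" by blast
  next
    assume *: "?proper \<and> ?no_mid"
    have "k \<le> 1" if "k \<in> L" for k
    proof (rule ccontr)
      assume "\<not> k \<le> 1"
      then obtain Qs where "?chain Qs" "3 \<le> length Qs" using \<open>k \<in> L\<close> by (auto simp: L_def)
      then show False using step2 * by blast
    qed
    then show "1 \<in> L \<and> (\<forall>k\<in>L. k \<le> 1)" using L1 * by blast
  qed
  ultimately show ?thesis by simp
qed

end

theorem proposition5p1:
  fixes p :: nat and F :: "'a fusion"
  assumes "saturated_fusion_system p F"
  shows "weakly_local_rank F = 1 \<longleftrightarrow> fessential p F = {fcore F}"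
proof -
  interpret saturated_fusion_system p F by (rule assms)
  let ?S = "carrier (fgrp F)"
  show ?thesis
    unfolding weakly_local_rank_eq_1_iff
  proof
    assume rank: "fcore F \<noteq> ?S \<and> (\<forall>R. fcore F \<subset> R \<and> weakly_centric_radical F R \<longrightarrow> R = ?S)"
    have "Q = fcore F" if "Q \<in> fessential p F" for Q
      using rank fcore_subset_essential[OF that] essential_weakly_centric_radical[OF that]
        fgrp_not_essential that by blast
    moreover have "fessential p F \<noteq> {}" using rank fcore_eq_fgrp_if_no_essential by blast
    ultimately show "fessential p F = {fcore F}" by blast
  next
    assume ess: "fessential p F = {fcore F}"
    have "fcore F \<noteq> ?S" using ess fgrp_not_essential by auto
    moreover have "R = ?S" if R: "fcore F \<subset> R" "weakly_centric_radical F R" for R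
    proof (rule ccontr)
      assume proper: "R \<noteq> ?S"
      have RG: "subgroup R (fgrp F)" using R(2) by (simp add: weakly_centric_radical_def)
      have "card (fcore F) < card R" by (rule psubset_card_mono[OF finite_subgroup[OF RG] R(1)])
      then show False
        using not_weakly_centric_radical_above_essentials[OF _ RG proper] ess R(2) by auto
    qed
    ultimately show "fcore F \<noteq> ?S \<and> (\<forall>R. fcore F \<subset> R \<and> weakly_centric_radical F R \<longrightarrow> R = ?S)"
      by blast
  qed
qed

end
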